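(* Let $f$ be either the Liouville function $\lambda$ or the Möbius function $\mu$. Then, as $n \to \infty$, $$\sum_{i=1}^{n}\sum_{j=1}^{n} f(i)f(j) = o(n^2).$$
   Context: For a positive integer $k$, $\lambda(k) = (-1)^{\nu(k)}$, where $\nu(k)$ is the number of prime factors of $k$ counted with multiplicity. The Möbius function is $\mu(k) = 1$ if $k$ is squarefree with an even number of prime factors (in particular $\mu(1)=1$), $\mu(k) = -1$ if $k$ is squarefree with an odd number of prime factors, and $\mu(k)=0$ if $k$ is not squarefree. *)

theory Defs
  imports
    Complex_Main
    "HOL-Library.Landau_Symbols"
    "HOL-Computational_Algebra.Computational_Algebra"
begin

(* Only positive arguments are meaningful; at 0, where prime_factorization 0 = {#},
   liouville takes the junk value 1 and moebius the value 0. *)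

definition num_prime_factors :: "nat \<Rightarrow> nat" where
  "num_prime_factors k = size (prime_factorization k)"

definition liouville :: "nat \<Rightarrow> int" where
  "liouville k = (-1) ^ num_prime_factors k"

definition moebius :: "nat \<Rightarrow> int" where
  "moebius k =
     (if squarefree k then if even (card (prime_factors k)) then 1 else -1 else 0)"

end

theory Submission
  imports
    "HOL-Complex_Analysis.Complex_Analysis"
    "HOL-Number_Theory.Prime_Powers"
    Defs
begin

text \<open>
  The double sum is the square of the summatory function of \<open>f\<close>, so the claim says that the mean of
  \<open>f\<close> over \<open>{1..n}\<close> tends to \<open>0\<close>. For the Moebius function this is one of the equivalent forms
  of the prime number theorem, and it is proved here by Newman's contour method.

  Because \<open>\<mu> * 1\<close> is the unit of Dirichlet convolution, \<open>\<Sum> \<mu>(n) n\<^sup>-\<^sup>s = 1 / \<zeta>(s)\<close> for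
  \<open>Re s > 1\<close>. The function \<open>Z(s) = (s - 1) \<zeta>(s)\<close> is holomorphic for \<open>Re s > 0\<close>
  (\<open>holomorphic_zeta_reg\<close>) and has no zero with \<open>Re s \<ge> 1\<close> (\<open>zeta_reg_nonzero\<close>); the latter is
  the classical consequence of \<open>3 + 4 cos \<theta> + cos 2\<theta> \<ge> 0\<close>. Hence \<open>(s - 1) / Z(s)\<close> continues the
  Dirichlet series of \<open>\<mu>\<close> to a neighbourhood of \<open>Re s \<ge> 1\<close> and vanishes at \<open>s = 1\<close>. Newman's
  Tauberian theorem (\<open>newman_tauberian\<close>) then yields \<open>\<Sum> \<mu>(n) / n = 0\<close>: boundedness of the
  coefficients and analyticity on the closed half-plane force convergence on the boundary.
  Kronecker's lemma (\<open>kronecker_mean_tendsto_0\<close>) turns this into a mean value \<open>0\<close> for \<open>\<mu>\<close>.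

  Finally every integer is a square times a squarefree number in a unique way, so that
  \<open>\<lambda>(n) = \<Sum> \<mu>(n / d\<^sup>2)\<close> over the squares \<open>d\<^sup>2\<close> dividing \<open>n\<close>. The mean of \<open>\<lambda>\<close> is thereby a
  combination of the means of \<open>\<mu>\<close> with the summable weights \<open>1 / d\<^sup>2\<close>, and it inherits the limit
  (\<open>liouville_mean_from_moebius_mean\<close>).
\<close>

section \<open>Convolution identities for the Moebius and Liouville functions\<close>

lemma prime_factorization_squarefree:
  assumes "squarefree (d :: nat)"
  shows "prime_factorization d = mset_set (prime_factors d)"
proof (rule multiset_eqI)
  fix p
  have "d \<noteq> 0" using assms by (metis not_squarefree_0)
  show "count (prime_factorization d) p = count (mset_set (prime_factors d)) p"
  proof (cases "p \<in> prime_factors d")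
    case True
    then have "prime p" by auto
    then have "multiplicity p d \<le> 1"
      using assms squarefree_factorial_semiring''[OF \<open>d \<noteq> 0\<close>] by blast
    moreover have "multiplicity p d = count (prime_factorization d) p"
      using \<open>prime p\<close> by (simp add: count_prime_factorization_prime)
    moreover have "count (prime_factorization d) p \<noteq> 0" using True by simp
    ultimately have "count (prime_factorization d) p = 1" by linarith
    then show ?thesis using True by simp
  qed (simp add: not_in_iff)
qed

lemma prime_factorization_prod_primes:
  assumes "finite X" "\<And>p. p \<in> X \<Longrightarrow> prime (p :: nat)"
  shows "prime_factorization (\<Prod>X) = mset_set X"
  using assms prime_factorization_prod_mset_primes[of "mset_set X"]
  by (simp add: prod_unfold_prod_mset)

text \<open>
  Only squarefree divisors contribute, and these are the products of the subsets \<open>X\<close> of the set of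
  prime factors of \<open>n\<close>. So the sum is \<open>\<Sum> (-1)\<^bsup>|X|\<^esup>\<close>, the expansion of a product of factors
  \<open>1 - 1\<close>, which is empty exactly for \<open>n = 1\<close>.
\<close>

lemma sum_moebius_divisors:
  assumes "n > 0"
  shows "(\<Sum>d | d dvd n. moebius d) = (if n = 1 then 1 else 0)"
proof -
  let ?P = "prime_factors n"
  have sub: "finite X" "\<And>p. p \<in> X \<Longrightarrow> prime p" if "X \<in> Pow ?P" for X
    using that by (auto dest: finite_subset)
  have "(\<Sum>d | d dvd n. moebius d) = (\<Sum>d | d dvd n \<and> squarefree d. moebius d)"
    using assms by (intro sum.mono_neutral_right) (auto simp: moebius_def)
  also have "\<dots> = (\<Sum>X\<in>Pow ?P. (-1) ^ card X)"
  proof (rule sum.reindex_bij_witness[where i = "\<lambda>X. \<Prod>X" and j = prime_factors])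
    fix d assume "d \<in> {d. d dvd n \<and> squarefree d}"
    then have d: "d dvd n" "squarefree d" by auto
    then have "d \<noteq> 0" by (metis not_squarefree_0)
    have "\<Prod>(prime_factors d) = prod_mset (prime_factorization d)"
      by (subst prime_factorization_squarefree[OF d(2)]) (simp add: prod_unfold_prod_mset)
    also have "\<dots> = d" using \<open>d \<noteq> 0\<close> by (simp add: prod_mset_prime_factorization_nat)
    finally show "\<Prod>(prime_factors d) = d" .
    show "prime_factors d \<in> Pow ?P"
      using d assms by (simp add: dvd_prime_factors)
    show "(-1) ^ card (prime_factors d) = moebius d"
      using d by (simp add: moebius_def)
  next
    fix X assume X: "X \<in> Pow ?P"
    have pf: "prime_factorization (\<Prod>X) = mset_set X"
      using sub[OF X] by (rule prime_factorization_prod_primes)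
    have nz: "\<Prod>X \<noteq> 0" using sub[OF X] by (metis not_prime_0 prod_zero_iff)
    show "prime_factors (\<Prod>X) = X" using pf sub[OF X] by simp
    have "mset_set X \<subseteq># mset_set ?P" using X by (intro subset_imp_msubset_mset_set) auto
    also have "\<dots> \<subseteq># prime_factorization n" by (rule mset_set_set_mset_msubset)
    finally have "\<Prod>X dvd n"
      using nz assms by (simp add: pf flip: prime_factorization_subset_iff_dvd)
    moreover have "squarefree (\<Prod>X)"
      unfolding squarefree_factorial_semiring''[OF nz]
    proof safe
      fix p :: nat assume "prime p"
      then have "multiplicity p (\<Prod>X) = count (mset_set X) p"
        by (simp add: pf flip: count_prime_factorization_prime)
      also have "\<dots> \<le> 1" by (simp add: count_mset_set')
      finally show "multiplicity p (\<Prod>X) \<le> 1" .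
    qed
    ultimately show "\<Prod>X \<in> {d. d dvd n \<and> squarefree d}" by simp
  qed
  also have "\<dots> = (\<Prod>p\<in>?P. 1 - 1 :: int)"
    by (subst prod_diff_conv_sum) auto
  also have "\<dots> = (if n = 1 then 1 else 0)"
    using assms by (simp add: prod_zero_iff prime_factorization_empty_iff power_0_left card_eq_0_iff)
  finally show ?thesis .
qed

text \<open>
  Write \<open>n = r q\<^sup>2\<close> with \<open>r\<close> squarefree. If \<open>d\<^sup>2\<close> divides \<open>n\<close> then \<open>d\<close> divides \<open>q\<close>, and the quotient
  \<open>n / d\<^sup>2\<close> keeps the square factor \<open>(q / d)\<^sup>2\<close>; it is squarefree only for \<open>d = q\<close>. The surviving
  term \<open>\<mu>(r)\<close> has the parity of the number of prime factors of \<open>n\<close>, since \<open>q\<^sup>2\<close> contributes an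
  even number of them.
\<close>

lemma liouville_eq_sum_moebius:
  assumes "n > 0"
  shows "liouville n = (\<Sum>d | d ^ 2 dvd n. moebius (n div d ^ 2))"
proof -
  define q where "q = square_part n"
  define r where "r = squarefree_part n"
  have n: "n = r * q ^ 2" unfolding r_def q_def by (rule squarefree_decompose)
  have q: "q > 0" using n assms by (cases "q = 0") auto
  have sf: "squarefree r" by (simp add: r_def)
  then have r: "r > 0" by (cases "r = 0") auto
  have fin: "finite {d. d ^ 2 dvd n}"
  proof (rule finite_subset)
    show "{d. d ^ 2 dvd n} \<subseteq> {d. d dvd n}" by (auto intro: dvd_trans[OF dvd_power])
  qed (use assms in auto)
  have "moebius (n div d ^ 2) = 0" if d: "d ^ 2 dvd n" "d \<noteq> q" for d
  proof -
    have "d dvd q" using d(1) by (simp add: q_def dvd_square_part_iff)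
    then obtain e where e: "q = d * e" by (elim dvdE)
    then have "d > 0" "e > 1" using q d(2) by (auto intro: Suc_lessI)
    have "n div d ^ 2 = r * e ^ 2" using \<open>d > 0\<close> by (simp add: n e power_mult_distrib)
    then have "e ^ 2 dvd n div d ^ 2" by simp
    then have "\<not> squarefree (n div d ^ 2)"
      using \<open>e > 1\<close> by (auto simp: squarefree_def)
    then show ?thesis by (simp add: moebius_def)
  qed
  then have "(\<Sum>d | d ^ 2 dvd n. moebius (n div d ^ 2)) = (\<Sum>d\<in>{q}. moebius (n div d ^ 2))"
    using fin by (intro sum.mono_neutral_right) (auto simp: n)
  also have "\<dots> = moebius r" using q by (simp add: n)
  also have "\<dots> = (-1) ^ size (prime_factorization r)"
    by (subst prime_factorization_squarefree[OF sf]) (use sf in \<open>simp add: moebius_def\<close>)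
  also have "\<dots> = liouville n"
    using q r by (simp add: liouville_def num_prime_factors_def n prime_factorization_mult
                    power2_eq_square power_add flip: power_mult_distrib)
  finally show ?thesis by simp
qed


section \<open>Products of Dirichlet series\<close>

lemma norm_nat_powr: "norm (of_nat n powr s :: complex) = real n powr Re s"
  by (subst norm_powr_real_powr) auto

text \<open>
  Absolute convergence permits summing the products of terms over all pairs \<open>(m, k)\<close> of positive
  integers in any order; here the pairs are grouped by the value \<open>n = m k\<close>. The index \<open>0\<close> is
  harmless throughout because \<open>0\<close> to any complex power is \<open>0\<close>.
\<close>

lemma dirichlet_product_sums:
  fixes a b :: "nat \<Rightarrow> complex"
  assumes a: "summable (\<lambda>n. norm (a n * of_nat n powr s))"
      and b: "summable (\<lambda>n. norm (b n * of_nat n powr s))"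
  shows "(\<lambda>n. (\<Sum>d | d dvd n. a d * b (n div d)) * of_nat n powr s) sums
           ((\<Sum>n. a n * of_nat n powr s) * (\<Sum>n. b n * of_nat n powr s))"
proof -
  define A where "A = (\<lambda>n. a n * of_nat n powr s)"
  define B where "B = (\<lambda>n. b n * of_nat n powr s)"
  have pos: "(h has_sum suminf h) {1..}"
    if "summable (\<lambda>n. norm (h n))" "h 0 = 0" for h :: "nat \<Rightarrow> 'b :: banach"
  proof -
    have "(h has_sum suminf h) UNIV"
      using that(1) by (intro norm_summable_imp_has_sum summable_sums) (auto dest: summable_norm_cancel)
    also have "?this \<longleftrightarrow> ?thesis"
      using that(2) by (intro has_sum_cong_neutral) (auto simp: not_less_eq_eq)
    finally show ?thesis .
  qed
  have A: "(A has_sum suminf A) {1..}"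
    unfolding A_def using a by (rule pos) simp
  have B: "(B has_sum suminf B) {1..}"
    unfolding B_def using b by (rule pos) simp
  have nA: "((\<lambda>n. norm (A n)) has_sum (\<Sum>n. norm (A n))) {1..}"
    unfolding A_def by (rule pos) (use a in simp_all)
  have nB: "((\<lambda>n. norm (B n)) has_sum (\<Sum>n. norm (B n))) {1..}"
    unfolding B_def by (rule pos) (use b in simp_all)
  have "(\<lambda>x. norm (A (fst x) * B (snd x))) summable_on ({1..} \<times> {1..})"
  proof (rule summable_on_SigmaI)
    fix m :: nat
    show "((\<lambda>k. norm (A (fst (m, k)) * B (snd (m, k)))) has_sum norm (A m) * (\<Sum>n. norm (B n))) {1..}"
      using has_sum_cmult_right[OF nB, of "norm (A m)"] by (simp add: norm_mult)
    show "(\<lambda>m. norm (A m) * (\<Sum>n. norm (B n))) summable_on {1..}"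
      using has_sum_cmult_left[OF nA] by (rule has_sum_imp_summable)
  qed auto
  then have "(\<lambda>x. A (fst x) * B (snd x)) summable_on ({1..} \<times> {1..})"
    by (rule abs_summable_summable)
  moreover have "((\<lambda>k. A (fst (m, k)) * B (snd (m, k))) has_sum A m * suminf B) {1..}" for m
    using has_sum_cmult_right[OF B, of "A m"] by simp
  ultimately have "((\<lambda>x. A (fst x) * B (snd x)) has_sum suminf A * suminf B) ({1..} \<times> {1..})"
    using has_sum_cmult_left[OF A, of "suminf B"] by (rule has_sum_SigmaI[rotated 2])
  also have "?this \<longleftrightarrow> ((\<lambda>(n, d). A d * B (n div d)) has_sum suminf A * suminf B)
                          (Sigma {1..} (\<lambda>n. {d. d dvd n}))"
    by (rule has_sum_reindex_bij_witness[where i = "\<lambda>(n, d). (d, n div d)" and j = "\<lambda>(m, k). (m * k, m)"])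
       (auto simp: Suc_le_eq elim!: dvdE)
  finally have "((\<lambda>n. \<Sum>d | d dvd n. A d * B (n div d)) has_sum suminf A * suminf B) {1..}"
    by (rule has_sum_SigmaD) (auto intro!: has_sum_finite)
  also have "?this \<longleftrightarrow> ((\<lambda>n. (\<Sum>d | d dvd n. a d * b (n div d)) * of_nat n powr s)
                          has_sum suminf A * suminf B) UNIV"
  proof (rule has_sum_cong_neutral)
    fix n :: nat assume "n \<in> {1..} \<inter> UNIV"
    have "A d * B (n div d) = a d * b (n div d) * of_nat n powr s" if "d dvd n" for d
    proof -
      have "of_nat n = complex_of_nat d * of_nat (n div d)"
        using that by (simp flip: of_nat_mult)
      also have "\<dots> powr s = of_nat d powr s * of_nat (n div d) powr s"
        by (rule powr_times_real) auto
      finally show ?thesis by (simp add: A_def B_def)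
    qed
    then show "(\<Sum>d | d dvd n. A d * B (n div d)) = (\<Sum>d | d dvd n. a d * b (n div d)) * of_nat n powr s"
      by (simp add: sum_distrib_right)
  qed (auto simp: not_less_eq_eq)
  finally show ?thesis
    unfolding A_def B_def by (rule has_sum_imp_sums)
qed


section \<open>Continuation of the zeta function beyond its pole\<close>

lemma norm_powr_diff_le:
  assumes "0 < a" "a \<le> x" "-1 \<le> Re s"
  shows "norm (complex_of_real x powr (-s) - complex_of_real a powr (-s))
           \<le> norm s * a powr (- Re s - 1) * (x - a)"
proof -
  let ?S = "closed_segment (complex_of_real a) (complex_of_real x)"
  have pt: "\<exists>t. z = complex_of_real t \<and> a \<le> t" if "z \<in> ?S" for z
    using that assms by (auto simp: closed_segment_of_real closed_segment_eq_real_ivl)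
  have "norm (complex_of_real x powr (-s) - complex_of_real a powr (-s))
          \<le> (norm s * a powr (- Re s - 1)) * norm (complex_of_real x - complex_of_real a)"
  proof (rule field_differentiable_bound[where S = ?S and f' = "\<lambda>z. (-s) * z powr (-s - 1)"])
    fix z assume "z \<in> ?S"
    then obtain t where t: "z = complex_of_real t" "a \<le> t" using pt by blast
    have "z \<notin> \<real>\<^sub>\<le>\<^sub>0" using t assms by (auto simp: complex_nonpos_Reals_iff)
    then show "((\<lambda>z. z powr (-s)) has_field_derivative (-s) * z powr (-s - 1)) (at z within ?S)"
      by (rule has_field_derivative_at_within[OF has_field_derivative_powr])
    have "norm (z powr (-s - 1)) = t powr (- Re s - 1)"
      using t assms by (simp add: norm_powr_real_powr)
    also have "\<dots> \<le> a powr (- Re s - 1)"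
      using t assms by (intro powr_mono2') auto
    finally show "norm ((-s) * z powr (-s - 1)) \<le> norm s * a powr (- Re s - 1)"
      by (simp add: norm_mult mult_left_mono)
  qed auto
  also have "norm (complex_of_real x - complex_of_real a) = x - a"
    using assms by (simp flip: of_real_diff)
  finally show ?thesis .
qed

text \<open>
  This is \<open>(s - 1)\<close> times the difference between \<open>n\<^sup>-\<^sup>s\<close> and the integral of \<open>x\<^sup>-\<^sup>s\<close> over
  \<open>[n, n + 1]\<close>. The factor \<open>s - 1\<close> clears the denominator of that integral, so each term is entire.
\<close>

definition zeta_term :: "nat \<Rightarrow> complex \<Rightarrow> complex" where
  "zeta_term n s = (s - 1) * of_nat n powr (-s) - of_nat n powr (1 - s) + of_nat (Suc n) powr (1 - s)"

text \<open>
  The function \<open>(s - 1) \<zeta>(s)\<close>, by comparison of the zeta series with the integral of \<open>x\<^sup>-\<^sup>s\<close>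
  over \<open>[1, \<infinity>)\<close>; the integral accounts for the summand \<open>1\<close>.
\<close>

definition zeta_reg :: "complex \<Rightarrow> complex" where
  "zeta_reg s = 1 + (\<Sum>n. zeta_term (Suc n) s)"

text \<open>
  The term is the increment over \<open>[n, n + 1]\<close> of a function whose derivative is
  \<open>(1 - s) (z\<^sup>-\<^sup>s - n\<^sup>-\<^sup>s)\<close>, so the mean value inequality applies twice. The gain of one power of \<open>n\<close>
  over \<open>n\<^sup>-\<^sup>s\<close> moves the region of convergence from \<open>Re s > 1\<close> to \<open>Re s > 0\<close>.
\<close>

lemma norm_zeta_term_le:
  assumes n: "n \<ge> 1" and s: "-1 \<le> Re s"
  shows "norm (zeta_term n s) \<le> norm (s - 1) * norm s * real n powr (- Re s - 1)"
proof -
  define \<phi> where "\<phi> = (\<lambda>z. (s - 1) * of_nat n powr (-s) * (z - of_nat n) + z powr (1 - s))"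
  let ?a = "complex_of_real (real n)" and ?b = "complex_of_real (real n + 1)"
  let ?S = "closed_segment ?a ?b"
  have pt: "\<exists>t. z = complex_of_real t \<and> real n \<le> t \<and> t \<le> real n + 1" if "z \<in> ?S" for z
    using that unfolding closed_segment_of_real by (auto simp: closed_segment_eq_real_ivl)
  have "norm (\<phi> ?b - \<phi> ?a) \<le> (norm (s - 1) * norm s * real n powr (- Re s - 1)) * norm (?b - ?a)"
  proof (rule field_differentiable_bound[where S = ?S and
           f' = "\<lambda>z. (s - 1) * of_nat n powr (-s) + (1 - s) * z powr (-s)"])
    fix z assume "z \<in> ?S"
    then obtain t where t: "z = complex_of_real t" "real n \<le> t" "t \<le> real n + 1" using pt by blast
    have z: "z \<notin> \<real>\<^sub>\<le>\<^sub>0" using t n by (auto simp: complex_nonpos_Reals_iff)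
    then have "((\<lambda>z. z powr (1 - s)) has_field_derivative (1 - s) * z powr (1 - s - 1)) (at z within ?S)"
      by (rule has_field_derivative_at_within[OF has_field_derivative_powr])
    then show "(\<phi> has_field_derivative (s - 1) * of_nat n powr (-s) + (1 - s) * z powr (-s)) (at z within ?S)"
      unfolding \<phi>_def using z by (auto intro!: derivative_eq_intros)
    have "(s - 1) * of_nat n powr (-s) + (1 - s) * z powr (-s)
            = (1 - s) * (complex_of_real t powr (-s) - complex_of_real (real n) powr (-s))"
      using t by (simp add: algebra_simps)
    also have "norm \<dots> \<le> norm (s - 1) * (norm s * real n powr (- Re s - 1) * (t - real n))"
      unfolding norm_mult norm_minus_commute[of 1 s]
      using t n s by (intro mult_left_mono norm_powr_diff_le) auto
    also have "\<dots> \<le> norm (s - 1) * (norm s * real n powr (- Re s - 1) * 1)"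
      using t by (intro mult_left_mono) auto
    finally show "norm ((s - 1) * of_nat n powr (-s) + (1 - s) * z powr (-s))
                    \<le> norm (s - 1) * norm s * real n powr (- Re s - 1)"
      by (simp add: mult_ac)
  qed auto
  moreover have "\<phi> ?b - \<phi> ?a = zeta_term n s"
    by (simp add: \<phi>_def zeta_term_def add.commute)
  ultimately show ?thesis by simp
qed

lemma summable_Suc_powr: "summable (\<lambda>n. real (Suc n) powr a)" if "a < -1"
  using that by (subst summable_Suc_iff) (simp add: summable_real_powr_iff)

lemma summable_zeta_term:
  assumes "Re s > 0"
  shows "summable (\<lambda>n. zeta_term (Suc n) s)"
proof (rule summable_comparison_test)
  show "\<exists>N. \<forall>n\<ge>N. norm (zeta_term (Suc n) s)
          \<le> norm (s - 1) * norm s * real (Suc n) powr (- Re s - 1)"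
    using assms by (intro exI[of _ 0] allI impI norm_zeta_term_le) auto
  show "summable (\<lambda>n. norm (s - 1) * norm s * real (Suc n) powr (- Re s - 1))"
    using assms by (intro summable_mult summable_Suc_powr) auto
qed

lemma holomorphic_zeta_reg: "zeta_reg holomorphic_on {s. Re s > 0}"
proof -
  have "(\<lambda>s. \<Sum>n. zeta_term (Suc n) s) holomorphic_on {s. Re s > 0}"
  proof (rule holomorphic_uniform_sequence)
    show "open {s. Re s > 0}" by (simp add: open_halfspace_Re_gt)
    show "(\<lambda>s. \<Sum>i<n. zeta_term (Suc i) s) holomorphic_on {s. Re s > 0}" for n
      unfolding zeta_term_def by (intro holomorphic_intros)
    fix s assume "s \<in> {s. Re s > 0}"
    then have s: "Re s > 0" by simp
    define d where "d = Re s / 2"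
    define B where "B = norm s + d"
    have cball: "Re s / 2 \<le> Re w \<and> norm w \<le> B" if "w \<in> cball s d" for w
    proof -
      have "norm (s - w) \<le> d" using that by (simp add: dist_norm)
      moreover have "\<bar>Re (s - w)\<bar> \<le> norm (s - w)" by (rule abs_Re_le_cmod)
      moreover have "norm w \<le> norm s + norm (s - w)"
        by (metis norm_triangle_sub norm_minus_commute)
      ultimately show ?thesis by (simp add: d_def B_def)
    qed
    have B0: "B \<ge> 0" using s by (simp add: B_def d_def)
    have "uniform_limit (cball s d) (\<lambda>n x. \<Sum>i<n. zeta_term (Suc i) x)
            (\<lambda>x. \<Sum>i. zeta_term (Suc i) x) sequentially"
    proof (rule Weierstrass_m_test)
      fix n w assume "w \<in> cball s d"
      then have w: "Re s / 2 \<le> Re w" "norm w \<le> B" using cball by blast+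
      have "norm (zeta_term (Suc n) w) \<le> norm (w - 1) * norm w * real (Suc n) powr (- Re w - 1)"
        using w s by (intro norm_zeta_term_le) auto
      also have "\<dots> \<le> (B + 1) * B * real (Suc n) powr (- Re s / 2 - 1)"
        using w B0 norm_triangle_ineq4[of w 1]
        by (intro mult_mono powr_mono) auto
      finally show "norm (zeta_term (Suc n) w) \<le> (B + 1) * B * real (Suc n) powr (- Re s / 2 - 1)" .
    next
      show "summable (\<lambda>n. (B + 1) * B * real (Suc n) powr (- Re s / 2 - 1))"
        using s by (intro summable_mult summable_Suc_powr) auto
    qed
    moreover have "cball s d \<subseteq> {s. Re s > 0}" using cball s by fastforce
    moreover have "d > 0" using s by (simp add: d_def)
    ultimately show "\<exists>d>0. cball s d \<subseteq> {s. Re s > 0} \<and>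
        uniform_limit (cball s d) (\<lambda>n x. \<Sum>i<n. zeta_term (Suc i) x)
            (\<lambda>x. \<Sum>i. zeta_term (Suc i) x) sequentially" by blast
  qed
  then show ?thesis
    unfolding zeta_reg_def[abs_def] by (intro holomorphic_intros)
qed

lemma zeta_reg_1: "zeta_reg 1 = 1"
  by (simp add: zeta_reg_def zeta_term_def del: of_nat_Suc)

text \<open>
  For \<open>Re s > 1\<close> the integral parts of the terms telescope to \<open>-1\<close>, which cancels the summand \<open>1\<close>
  in the definition and leaves the zeta series.
\<close>

lemma sums_zeta_reg:
  assumes "Re s > 1"
  shows "(\<lambda>n. of_nat n powr (-s)) sums (zeta_reg s / (s - 1))"
proof -
  let ?p = "\<lambda>n. complex_of_nat (Suc n) powr (1 - s)"
  have "?p \<longlonglongrightarrow> 0"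
  proof (rule tendsto_norm_zero_cancel)
    have "(\<lambda>n. real (Suc n) powr (1 - Re s)) \<longlonglongrightarrow> 0"
      using assms by (intro tendsto_neg_powr filterlim_compose[OF filterlim_real_sequentially] filterlim_Suc) auto
    then show "(\<lambda>n. norm (?p n)) \<longlonglongrightarrow> 0"
      by (simp only: norm_nat_powr minus_complex.sel one_complex.sel)
  qed
  then have "(\<lambda>n. ?p (Suc n) - ?p n) sums (0 - ?p 0)" by (rule telescope_sums)
  moreover have "(\<lambda>n. zeta_term (Suc n) s) sums (zeta_reg s - 1)"
    using summable_zeta_term[of s] assms by (simp add: zeta_reg_def summable_sums)
  ultimately have "(\<lambda>n. zeta_term (Suc n) s - (?p (Suc n) - ?p n)) sums (zeta_reg s - 1 - (0 - ?p 0))"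
    by (rule sums_diff[rotated])
  then have "(\<lambda>n. (s - 1) * of_nat (Suc n) powr (-s)) sums zeta_reg s"
    by (simp add: zeta_term_def)
  then have "(\<lambda>n. (s - 1) * of_nat (Suc n) powr (-s) / (s - 1)) sums (zeta_reg s / (s - 1))"
    by (rule sums_divide)
  moreover have "s \<noteq> 1" using assms by auto
  ultimately have "(\<lambda>n. of_nat (Suc n) powr (-s)) sums (zeta_reg s / (s - 1))" by simp
  then show ?thesis by (subst (asm) sums_Suc_iff) simp
qed


section \<open>The reciprocal and the logarithmic derivative as Dirichlet series\<close>

text \<open>
  The product of the series of \<open>\<mu>\<close> with the zeta series has the single coefficient \<open>1\<close> at \<open>n = 1\<close>.
  So neither factor vanishes, and they are reciprocal to each other.
\<close>

lemma moebius_series_reciprocal: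
  assumes s: "Re s > 1"
  shows zeta_reg_nonzero_right: "zeta_reg s \<noteq> 0"
    and sums_moebius: "(\<lambda>n. of_int (moebius n) * of_nat n powr (-s)) sums ((s - 1) / zeta_reg s)"
proof -
  have "s \<noteq> 1" using s by auto
  have inv: "X = u / Z" if "X * (Z / u) = 1" "u \<noteq> 0" "Z \<noteq> 0" for X u Z :: complex
  proof -
    have "X = X * (Z / u) * (u / Z)" using that(2,3) by simp
    then show ?thesis using that(1) by simp
  qed
  have one: "summable (\<lambda>n. norm (1 * of_nat n powr (-s) :: complex))"
    using s by (simp add: norm_nat_powr summable_real_powr_iff)
  have mu: "summable (\<lambda>n. norm (of_int (moebius n) * of_nat n powr (-s) :: complex))"
    by (rule summable_comparison_test'[OF one, of 0]) (auto simp: norm_mult moebius_def)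
  have "(\<lambda>n. (\<Sum>d | d dvd n. of_int (moebius d) * 1) * of_nat n powr (-s)) sums
          ((\<Sum>n. of_int (moebius n) * of_nat n powr (-s)) * (\<Sum>n. 1 * of_nat n powr (-s)))"
    using mu one by (rule dirichlet_product_sums)
  also have "(\<lambda>n. (\<Sum>d | d dvd n. of_int (moebius d) * 1) * of_nat n powr (-s))
               = (\<lambda>n. if n = 1 then 1 else 0 :: complex)"
  proof
    fix n :: nat
    show "(\<Sum>d | d dvd n. of_int (moebius d) * 1) * of_nat n powr (-s) = (if n = 1 then 1 else 0 :: complex)"
      using sum_moebius_divisors[of n] by (cases "n = 0") (auto simp flip: of_int_sum)
  qed
  also have "(\<Sum>n. 1 * of_nat n powr (-s)) = zeta_reg s / (s - 1)"
    using sums_zeta_reg[OF s] by (simp add: sums_iff)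
  finally have prod: "(\<Sum>n. of_int (moebius n) * of_nat n powr (-s)) * (zeta_reg s / (s - 1)) = 1"
    using sums_single[of 1 "\<lambda>_. 1 :: complex"] by (rule sums_unique2)
  then show nz: "zeta_reg s \<noteq> 0" by auto
  have "(\<lambda>n. of_int (moebius n) * of_nat n powr (-s)) sums (\<Sum>n. of_int (moebius n) * of_nat n powr (-s) :: complex)"
    using summable_norm_cancel[OF mu] by (rule summable_sums)
  also have "(\<Sum>n. of_int (moebius n) * of_nat n powr (-s)) = (s - 1) / zeta_reg s"
    by (rule inv[OF prod]) (use nz \<open>s \<noteq> 1\<close> in auto)
  finally show "(\<lambda>n. of_int (moebius n) * of_nat n powr (-s)) sums ((s - 1) / zeta_reg s)" .
qed

lemma summable_ln_powr:
  assumes "\<sigma> > 1"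
  shows "summable (\<lambda>n. ln (real n) * real n powr (-\<sigma>))"
proof (rule summable_comparison_test')
  \<comment> \<open>Half of the excess of \<open>\<sigma>\<close> over \<open>1\<close> pays for the logarithm.\<close>
  let ?e = "(\<sigma> - 1) / 2"
  show "summable (\<lambda>n. 1 / ?e * real n powr (?e - \<sigma>))"
    using assms by (intro summable_mult) (simp add: summable_real_powr_iff field_simps)
  fix n :: nat assume n: "n \<ge> 1"
  have "ln (real n) * real n powr (-\<sigma>) \<le> (real n powr ?e / ?e) * real n powr (-\<sigma>)"
    using assms n by (intro mult_right_mono ln_powr_bound) auto
  also have "\<dots> = 1 / ?e * real n powr (?e - \<sigma>)"
    using powr_add[of "real n" ?e "-\<sigma>"] by simp
  finally show "norm (ln (real n) * real n powr (-\<sigma>)) \<le> 1 / ?e * real n powr (?e - \<sigma>)"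
    using n by simp
qed

text \<open>
  Termwise differentiation, justified by uniform convergence of the undifferentiated series near \<open>s\<close>.
\<close>

lemma sums_deriv_zeta:
  assumes s: "Re s > 1"
  shows "(\<lambda>n. of_real (ln (real n)) * of_nat n powr (-s)) sums
           (- deriv (\<lambda>s. zeta_reg s / (s - 1)) s)"
proof -
  let ?S = "{s. Re s > 1}"
  have "\<exists>g g'. \<forall>x\<in>?S. (\<lambda>n. of_nat n powr (-x)) sums g x \<and>
           (\<lambda>n. - of_real (ln (real n)) * of_nat n powr (-x)) sums g' x \<and>
           (g has_field_derivative g' x) (at x)"
  proof (rule series_and_derivative_comparison_local)
    show "open ?S" by (rule open_halfspace_Re_gt)
    fix n :: nat and x :: complex
    show "((\<lambda>x. of_nat n powr (-x)) has_field_derivative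
             - of_real (ln (real n)) * of_nat n powr (-x)) (at x)"
    proof (cases "n = 0")
      case False
      have neg: "((\<lambda>x. - x) has_field_derivative - 1) (at x)"
        by (auto intro!: derivative_eq_intros)
      have "((\<lambda>x. of_nat n powr (-x)) has_field_derivative
               (Ln (of_nat n) * of_nat n powr (-x)) * (- 1)) (at x)"
        using False by (intro DERIV_chain2[OF has_field_derivative_powr_right neg]) auto
      then show ?thesis using False by (simp add: Ln_of_nat)
    qed auto
  next
    fix x assume "x \<in> ?S"
    \<comment> \<open>On the ball of this radius the real part stays at or above \<open>1 + d\<close>.\<close>
    define d where "d = (Re x - 1) / 2"
    have "norm (of_nat n powr (-y) :: complex) \<le> real n powr (-(1 + d))" if "y \<in> ball x d" for n y
    proof -
      have "\<bar>Re (x - y)\<bar> \<le> norm (x - y)" by (rule abs_Re_le_cmod)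
      then have "Re y \<ge> 1 + d" using that by (simp add: dist_norm d_def field_simps)
      then show ?thesis
        by (cases "n = 0") (auto simp: norm_nat_powr intro!: powr_mono)
    qed
    moreover have "summable (\<lambda>n. real n powr (-(1 + d)))" "d > 0"
      using \<open>x \<in> ?S\<close> by (auto simp: d_def summable_real_powr_iff)
    ultimately show "\<exists>d h. 0 < d \<and> summable h \<and>
        (\<forall>\<^sub>F n in sequentially. \<forall>y\<in>ball x d \<inter> ?S. norm (of_nat n powr (-y) :: complex) \<le> h n)"
      by (intro exI[of _ d] exI[of _ "\<lambda>n. real n powr (-(1 + d))"]) auto
  qed
  then obtain g g' where gg: "\<forall>x\<in>?S. (\<lambda>n. of_nat n powr (-x)) sums g x \<and>
           (\<lambda>n. - of_real (ln (real n)) * of_nat n powr (-x)) sums g' x \<and>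
           (g has_field_derivative g' x) (at x)" by (elim exE)
  have g: "\<And>x. x \<in> ?S \<Longrightarrow> (\<lambda>n. of_nat n powr (-x)) sums g x"
     "\<And>x. x \<in> ?S \<Longrightarrow> (\<lambda>n. - of_real (ln (real n)) * of_nat n powr (-x)) sums g' x"
     "\<And>x. x \<in> ?S \<Longrightarrow> (g has_field_derivative g' x) (at x)" using gg by blast+
  have "((\<lambda>s. zeta_reg s / (s - 1)) has_field_derivative g' s) (at s)"
  proof (rule has_field_derivative_transform_within_open)
    show "(g has_field_derivative g' s) (at s)" using g(3) s by simp
    show "g x = zeta_reg x / (x - 1)" if "x \<in> ?S" for x
      using that by (intro sums_unique2[OF g(1) sums_zeta_reg]) auto
  qed (use s open_halfspace_Re_gt in auto)
  then have "deriv (\<lambda>s. zeta_reg s / (s - 1)) s = g' s" by (rule DERIV_imp_deriv)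
  then show ?thesis using sums_minus[OF g(2)[of s]] s by simp
qed

text \<open>
  The divisor sums of the von Mangoldt function are logarithms, so its series times \<open>\<zeta>\<close> is \<open>-\<zeta>'\<close>.
  The right-hand side is \<open>-\<zeta>' / \<zeta>\<close> written in terms of \<open>(s - 1) \<zeta>(s)\<close>, which separates the pole
  at \<open>1\<close> from the contribution of the zeros.
\<close>

lemma sums_mangoldt:
  assumes s: "Re s > 1"
  shows "(\<lambda>n. mangoldt n * of_nat n powr (-s)) sums (1 / (s - 1) - deriv zeta_reg s / zeta_reg s)"
proof -
  have s1: "s \<noteq> 1" using s by auto
  have alg: "X = 1 / u - D / Z" if "X * (Z / u) = - ((D * u - Z) / u ^ 2)" "u \<noteq> 0" "Z \<noteq> 0"
    for X Z D u :: complex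
  proof -
    have "X * (Z * u) = X * (Z / u) * u ^ 2" using that(2) by (simp add: power2_eq_square)
    also have "\<dots> = Z - D * u" unfolding that(1) using that(2) by simp
    finally have "X = (Z - D * u) / (Z * u)" using that(2,3) by (simp add: eq_divide_eq)
    also have "\<dots> = 1 / u - D / Z" using that(2,3) by (simp add: diff_divide_distrib)
    finally show ?thesis .
  qed
  have one: "summable (\<lambda>n. norm (1 * of_nat n powr (-s) :: complex))"
    using s by (simp add: norm_nat_powr summable_real_powr_iff)
  have mg: "summable (\<lambda>n. norm (mangoldt n * of_nat n powr (-s) :: complex))"
  proof (rule summable_comparison_test'[OF summable_ln_powr[OF s], of 1])
    fix n :: nat assume "n \<ge> 1"
    then have "mangoldt n * real n powr (- Re s) \<le> ln (real n) * real n powr (- Re s)"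
      by (intro mult_right_mono mangoldt_le) auto
    then show "norm (norm (mangoldt n * of_nat n powr (-s) :: complex)) \<le> ln (real n) * real n powr (- Re s)"
      by (simp add: norm_mult norm_nat_powr abs_mult)
  qed
  have "(\<lambda>n. (\<Sum>d | d dvd n. mangoldt d * 1) * of_nat n powr (-s)) sums
          ((\<Sum>n. mangoldt n * of_nat n powr (-s)) * (\<Sum>n. 1 * of_nat n powr (-s)))"
    using mg one by (rule dirichlet_product_sums)
  also have "(\<lambda>n. (\<Sum>d | d dvd n. mangoldt d * 1) * of_nat n powr (-s))
               = (\<lambda>n. of_real (ln (real n)) * of_nat n powr (-s) :: complex)"
  proof
    fix n :: nat
    show "(\<Sum>d | d dvd n. mangoldt d * 1) * of_nat n powr (-s) = of_real (ln (real n)) * (of_nat n powr (-s) :: complex)"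
      by (cases "n = 0") (simp_all add: mangoldt_sum)
  qed
  also have "(\<Sum>n. 1 * of_nat n powr (-s)) = zeta_reg s / (s - 1)"
    using sums_zeta_reg[OF s] by (simp add: sums_iff)
  finally have "(\<Sum>n. mangoldt n * of_nat n powr (-s)) * (zeta_reg s / (s - 1))
                  = - deriv (\<lambda>s. zeta_reg s / (s - 1)) s"
    using sums_deriv_zeta[OF s] by (rule sums_unique2)
  also have "deriv (\<lambda>s. zeta_reg s / (s - 1)) s = (deriv zeta_reg s * (s - 1) - zeta_reg s) / (s - 1) ^ 2"
  proof (rule DERIV_imp_deriv)
    have "(zeta_reg has_field_derivative deriv zeta_reg s) (at s)"
      using s by (intro holomorphic_derivI[OF holomorphic_zeta_reg open_halfspace_Re_gt]) auto
    then show "((\<lambda>s. zeta_reg s / (s - 1)) has_field_derivative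
            (deriv zeta_reg s * (s - 1) - zeta_reg s) / (s - 1) ^ 2) (at s)"
      using s1 by (auto intro!: derivative_eq_intros simp: power2_eq_square)
  qed
  finally have "(\<Sum>n. mangoldt n * of_nat n powr (-s)) = 1 / (s - 1) - deriv zeta_reg s / zeta_reg s"
    by (rule alg) (use s1 zeta_reg_nonzero_right[OF s] in auto)
  moreover have "summable (\<lambda>n. mangoldt n * of_nat n powr (-s) :: complex)"
    using mg by (rule summable_norm_cancel)
  ultimately show ?thesis by (simp add: sums_iff)
qed


section \<open>Non-vanishing on the line of real part one\<close>

lemma Re_nat_powr: "n > 0 \<Longrightarrow> Re (of_nat n powr (- Complex \<sigma> t)) = real n powr (-\<sigma>) * cos (t * ln (real n))"
  by (simp add: powr_def Ln_of_nat Re_exp mult.commute)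

text \<open>
  The coefficients of \<open>-\<zeta>' / \<zeta>\<close> are nonnegative, and
  \<open>3 + 4 cos \<theta> + cos 2\<theta> = 2 (1 + cos \<theta>)\<^sup>2\<close> is nonnegative for every angle \<open>\<theta> = t ln n\<close>.
\<close>

lemma mertens_inequality:
  fixes \<sigma> t :: real
  defines "L \<equiv> \<lambda>s. 1 / (s - 1) - deriv zeta_reg s / zeta_reg s"
  assumes "\<sigma> > 1"
  shows "3 * Re (L (Complex \<sigma> 0)) + 4 * Re (L (Complex \<sigma> t)) + Re (L (Complex \<sigma> (2 * t))) \<ge> 0"
proof -
  have "(\<lambda>n. Re (mangoldt n * of_nat n powr (- Complex \<sigma> u))) sums Re (L (Complex \<sigma> u))" for u
    unfolding L_def using assms by (intro sums_Re sums_mangoldt) auto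
  then have series: "(\<lambda>n. 3 * Re (mangoldt n * of_nat n powr (- Complex \<sigma> 0))
           + 4 * Re (mangoldt n * of_nat n powr (- Complex \<sigma> t))
           + Re (mangoldt n * of_nat n powr (- Complex \<sigma> (2 * t)))) sums
        (3 * Re (L (Complex \<sigma> 0)) + 4 * Re (L (Complex \<sigma> t)) + Re (L (Complex \<sigma> (2 * t))))"
    by (intro sums_add sums_mult)
  have nonneg: "3 * Re (mangoldt n * of_nat n powr (- Complex \<sigma> 0))
           + 4 * Re (mangoldt n * of_nat n powr (- Complex \<sigma> t))
           + Re (mangoldt n * of_nat n powr (- Complex \<sigma> (2 * t))) \<ge> 0" for n
  proof (cases "n = 0")
    case False
    define M where "M = mangoldt n * real n powr (-\<sigma>)"
    let ?c = "cos (t * ln (real n))"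
    have "Re (mangoldt n * of_nat n powr (- Complex \<sigma> u)) = M * cos (u * ln (real n))" for u
    proof -
      have "Re (mangoldt n * of_nat n powr (- Complex \<sigma> u))
              = mangoldt n * Re (of_nat n powr (- Complex \<sigma> u))" by (simp del: mult_eq_0_iff)
      then show ?thesis using False by (simp only: Re_nat_powr M_def mult.assoc not_gr_zero gr0I)
    qed
    moreover have "cos (2 * t * ln (real n)) = 2 * ?c ^ 2 - 1"
      using cos_double_cos[of "t * ln (real n)"] by (simp add: mult.assoc)
    moreover have "3 * (M * cos (0 * l)) + 4 * (M * c) + M * (2 * c ^ 2 - 1) = M * (2 * (1 + c) ^ 2)"
      for c l :: real by (simp add: power2_eq_square algebra_simps)
    ultimately have "3 * Re (mangoldt n * of_nat n powr (- Complex \<sigma> 0))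
           + 4 * Re (mangoldt n * of_nat n powr (- Complex \<sigma> t))
           + Re (mangoldt n * of_nat n powr (- Complex \<sigma> (2 * t)))
         = M * (2 * (1 + ?c) ^ 2)"
      by (simp only:)
    also have "\<dots> \<ge> 0"
      unfolding M_def by (intro mult_nonneg_nonneg mangoldt_nonneg) auto
    finally show ?thesis .
  qed auto
  show ?thesis by (rule sums_le[OF nonneg sums_zero series])
qed

text \<open>
  The limit is the order of the zero of \<open>f\<close> at \<open>z0\<close>: after splitting off \<open>(z - z0)\<^sup>m\<close> the
  logarithmic derivative is \<open>m / (z - z0)\<close> plus a function continuous at \<open>z0\<close>.
\<close>

lemma tendsto_log_deriv_order:
  assumes f: "f holomorphic_on S" "open S" "connected S" and z0: "z0 \<in> S" and w: "w \<in> S" "f w \<noteq> 0"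
  shows "\<exists>m::nat. (m = 0 \<longleftrightarrow> f z0 \<noteq> 0) \<and>
           ((\<lambda>z. (z - z0) * (deriv f z / f z)) \<longlongrightarrow> of_nat m) (at z0)"
proof -
  have "\<exists>g r m. 0 < r \<and> ball z0 r \<subseteq> S \<and> g holomorphic_on ball z0 r \<and> (m = 0 \<longleftrightarrow> f z0 \<noteq> 0) \<and>
          (\<forall>z\<in>ball z0 r. f z = (z - z0) ^ m * g z) \<and> (\<forall>z\<in>ball z0 r. g z \<noteq> 0)"
  proof (cases "f z0 = 0")
    case True
    then have "\<not> f constant_on S" using z0 w by (force simp: constant_on_def)
    from holomorphic_factor_zero_nonconstant[OF f z0 True this] show ?thesis
      using True by (metis less_not_refl)
  next
    case False
    have "continuous (at z0) f"
      using f z0 holomorphic_on_imp_continuous_on continuous_on_eq_continuous_at by blast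
    then obtain e where e: "e > 0" "\<And>z. dist z0 z < e \<Longrightarrow> f z \<noteq> 0"
      using continuous_at_avoid[of z0 f 0] False by auto
    obtain r where r: "r > 0" "ball z0 r \<subseteq> S" using f z0 by (auto simp: open_contains_ball)
    have sub: "ball z0 (min e r) \<subseteq> S" using r(2) by auto
    show ?thesis
      using e r False sub holomorphic_on_subset[OF f(1) sub]
      by (intro exI[of _ f] exI[of _ "min e r"] exI[of _ 0]) auto
  qed
  then obtain g r m where r: "0 < r" and g: "g holomorphic_on ball z0 r"
    and m: "m = 0 \<longleftrightarrow> f z0 \<noteq> 0" and fg: "\<And>z. z \<in> ball z0 r \<Longrightarrow> f z = (z - z0) ^ m * g z"
    and nz: "\<And>z. z \<in> ball z0 r \<Longrightarrow> g z \<noteq> 0" by metis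
  have "continuous_on (ball z0 r) (deriv g)" "continuous_on (ball z0 r) g"
    using g by (auto intro!: holomorphic_on_imp_continuous_on holomorphic_deriv)
  then have "(deriv g \<longlongrightarrow> deriv g z0) (at z0)" "(g \<longlongrightarrow> g z0) (at z0)"
    using r by (auto simp: continuous_on_eq_continuous_at continuous_at)
  then have "((\<lambda>z. of_nat m + (z - z0) * (deriv g z / g z)) \<longlongrightarrow> of_nat m + (z0 - z0) * (deriv g z0 / g z0)) (at z0)"
    using nz[of z0] r by (intro tendsto_intros) auto
  moreover have "eventually (\<lambda>z. of_nat m + (z - z0) * (deriv g z / g z) = (z - z0) * (deriv f z / f z)) (at z0)"
  proof -
    have "eventually (\<lambda>z. z \<in> ball z0 r - {z0}) (at z0)"
      using r by (intro eventually_at_in_open) auto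
    then show ?thesis
    proof eventually_elim
      case (elim z)
      have "(g has_field_derivative deriv g z) (at z)"
        using elim by (intro holomorphic_derivI[OF g]) auto
      then have "((\<lambda>z. (z - z0) ^ m * g z) has_field_derivative
               of_nat m * (z - z0) ^ (m - 1) * g z + (z - z0) ^ m * deriv g z) (at z)"
        by (auto intro!: derivative_eq_intros)
      then have "(f has_field_derivative
               of_nat m * (z - z0) ^ (m - 1) * g z + (z - z0) ^ m * deriv g z) (at z)"
        by (rule has_field_derivative_transform_within_open[of _ _ _ "ball z0 r"]) (use elim fg in auto)
      then have "deriv f z = of_nat m * (z - z0) ^ (m - 1) * g z + (z - z0) ^ m * deriv g z"
        by (rule DERIV_imp_deriv)
      moreover define u where "u = z - z0"
      ultimately have "u * deriv f z = u * (of_nat m * u ^ (m - 1) * g z + u ^ m * deriv g z)"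
        by simp
      also have "\<dots> = u ^ m * (of_nat m * g z + u * deriv g z)"
        by (cases m) (simp_all add: algebra_simps)
      finally have "u * (deriv f z / f z) = u ^ m * (of_nat m * g z + u * deriv g z) / (u ^ m * g z)"
        using elim by (simp add: fg u_def)
      also have "\<dots> = of_nat m + u * (deriv g z / g z)"
        using elim nz[of z] by (simp add: u_def add_divide_distrib)
      finally show ?case by (simp add: u_def)
    qed
  qed
  ultimately have "((\<lambda>z. (z - z0) * (deriv f z / f z)) \<longlongrightarrow> of_nat m + (z0 - z0) * (deriv g z0 / g z0)) (at z0)"
    by (rule Lim_transform_eventually)
  then show ?thesis using m by (intro exI[of _ m]) simp
qed

text \<open>
  Multiply \<open>mertens_inequality\<close> by \<open>\<sigma> - 1\<close> and let \<open>\<sigma>\<close> decrease to \<open>1\<close>. The pole at \<open>1\<close> contributes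
  \<open>3\<close>, while zeros of orders \<open>m\<^sub>1\<close> at \<open>1 + it\<close> and \<open>m\<^sub>2\<close> at \<open>1 + 2it\<close> contribute
  \<open>-4 m\<^sub>1 - m\<^sub>2\<close>. So \<open>4 m\<^sub>1 \<le> 3\<close>, that is \<open>m\<^sub>1 = 0\<close>.
\<close>

lemma zeta_reg_nonzero:
  assumes "Re s \<ge> 1"
  shows "zeta_reg s \<noteq> 0"
proof (cases "Re s = 1 \<and> Im s \<noteq> 0")
  case False
  then consider "Re s > 1" | "s = 1"
    using assms by (cases "Re s > 1") (auto simp: complex_eq_iff)
  then show ?thesis by cases (auto simp: zeta_reg_1 zeta_reg_nonzero_right)
next
  case True
  define t where "t = Im s"
  have s: "s = Complex 1 t" and t: "t \<noteq> 0" using True by (auto simp: t_def complex_eq_iff)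
  define L where "L = (\<lambda>s. 1 / (s - 1) - deriv zeta_reg s / zeta_reg s)"
  \<comment> \<open>\<open>ord_at u m\<close>: the order \<open>m\<close> of the zero at \<open>1 + iu\<close> is visible in the growth of \<open>-\<zeta>' / \<zeta>\<close>
    on approach from the right, where the pole at \<open>u = 0\<close> adds \<open>1\<close>.\<close>
  define ord_at where "ord_at = (\<lambda>u m. (m = 0 \<longleftrightarrow> zeta_reg (Complex 1 u) \<noteq> 0) \<and>
          ((\<lambda>\<sigma>. (\<sigma> - 1) * Re (L (Complex \<sigma> u))) \<longlongrightarrow> (if u = 0 then 1 else 0) - real m) (at_right 1))"
  have lim: "\<exists>m. ord_at u m" for u
  proof -
    have "connected {s. Re s > 0}" by (intro convex_connected convex_halfspace_Re_gt)
    then have "\<exists>m::nat. (m = 0 \<longleftrightarrow> zeta_reg (Complex 1 u) \<noteq> 0) \<and>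
        ((\<lambda>z. (z - Complex 1 u) * (deriv zeta_reg z / zeta_reg z)) \<longlongrightarrow> of_nat m) (at (Complex 1 u))"
      by (rule tendsto_log_deriv_order[OF holomorphic_zeta_reg open_halfspace_Re_gt, where w = 1])
         (simp_all add: zeta_reg_1)
    then obtain m :: nat where m: "m = 0 \<longleftrightarrow> zeta_reg (Complex 1 u) \<noteq> 0"
      and lim: "((\<lambda>z. (z - Complex 1 u) * (deriv zeta_reg z / zeta_reg z)) \<longlongrightarrow> of_nat m) (at (Complex 1 u))"
      by (elim exE conjE)
    have cont: "((\<lambda>\<sigma>. Complex \<sigma> u) \<longlongrightarrow> Complex 1 u) (at_right 1)"
      by (intro tendsto_Complex tendsto_intros)
    then have "filterlim (\<lambda>\<sigma>. Complex \<sigma> u) (at (Complex 1 u)) (at_right 1)"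
      by (auto simp: filterlim_at eventually_at_filter complex_eq_iff)
    then have "((\<lambda>\<sigma>. (Complex \<sigma> u - Complex 1 u) * (deriv zeta_reg (Complex \<sigma> u) / zeta_reg (Complex \<sigma> u)))
              \<longlongrightarrow> of_nat m) (at_right 1)"
      by (rule filterlim_compose[OF lim])
    moreover have "((\<lambda>\<sigma>. of_real (\<sigma> - 1) * (1 / (Complex \<sigma> u - 1))) \<longlongrightarrow> (if u = 0 then 1 else 0)) (at_right 1)"
    proof (cases "u = 0")
      case True
      have "eventually (\<lambda>\<sigma>::real. \<sigma> > 1) (at_right 1)" by (rule eventually_at_right_less)
      then have "eventually (\<lambda>\<sigma>. 1 = of_real (\<sigma> - 1) * (1 / (Complex \<sigma> u - 1))) (at_right 1)"
      proof eventually_elim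
        case (elim \<sigma>)
        have "Complex \<sigma> u - 1 = of_real (\<sigma> - 1)" using True by (simp add: complex_eq_iff)
        then show ?case using elim by (simp del: of_real_diff)
      qed
      then show ?thesis using True by (simp add: Lim_transform_eventually[OF tendsto_const])
    next
      case False
      have "((\<lambda>\<sigma>. of_real (\<sigma> - 1) * (1 / (Complex \<sigma> u - 1))) \<longlongrightarrow> of_real (1 - 1) * (1 / (Complex 1 u - 1))) (at_right 1)"
        using False by (intro tendsto_intros cont) (auto simp: complex_eq_iff)
      then show ?thesis using False by simp
    qed
    ultimately have "((\<lambda>\<sigma>. of_real (\<sigma> - 1) * (1 / (Complex \<sigma> u - 1)) -
         (Complex \<sigma> u - Complex 1 u) * (deriv zeta_reg (Complex \<sigma> u) / zeta_reg (Complex \<sigma> u)))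
              \<longlongrightarrow> (if u = 0 then 1 else 0) - of_nat m) (at_right 1)"
      by (intro tendsto_diff)
    also have "(\<lambda>\<sigma>. of_real (\<sigma> - 1) * (1 / (Complex \<sigma> u - 1)) -
         (Complex \<sigma> u - Complex 1 u) * (deriv zeta_reg (Complex \<sigma> u) / zeta_reg (Complex \<sigma> u)))
           = (\<lambda>\<sigma>. of_real (\<sigma> - 1) * L (Complex \<sigma> u))"
    proof
      fix \<sigma> :: real
      have "Complex \<sigma> u - Complex 1 u = of_real (\<sigma> - 1)" by (simp add: complex_eq_iff)
      then show "of_real (\<sigma> - 1) * (1 / (Complex \<sigma> u - 1)) -
         (Complex \<sigma> u - Complex 1 u) * (deriv zeta_reg (Complex \<sigma> u) / zeta_reg (Complex \<sigma> u))
           = of_real (\<sigma> - 1) * L (Complex \<sigma> u)"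
        by (simp only: L_def right_diff_distrib)
    qed
    finally have "((\<lambda>\<sigma>. Re (of_real (\<sigma> - 1) * L (Complex \<sigma> u))) \<longlongrightarrow> Re ((if u = 0 then 1 else 0) - of_nat m)) (at_right 1)"
      by (rule tendsto_Re)
    moreover have "Re (of_real (\<sigma> - 1) * w) = (\<sigma> - 1) * Re w" for \<sigma> w
      by (simp del: of_real_diff)
    moreover have "Re ((if u = 0 then 1 else 0) - of_nat m) = (if u = 0 then 1 else 0) - real m"
      by simp
    ultimately show ?thesis
      unfolding ord_at_def using m by (intro exI[of _ m] conjI) (simp_all only:)
  qed
  obtain m0 m1 m2 where ord: "ord_at 0 m0" "ord_at t m1" "ord_at (2 * t) m2"
    using lim by blast
  have m0: "m0 = 0 \<longleftrightarrow> zeta_reg (Complex 1 0) \<noteq> 0"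
      "((\<lambda>\<sigma>. (\<sigma> - 1) * Re (L (Complex \<sigma> 0))) \<longlongrightarrow> 1 - real m0) (at_right 1)"
    using ord(1) by (simp_all add: ord_at_def)
  have m1: "m1 = 0 \<longleftrightarrow> zeta_reg (Complex 1 t) \<noteq> 0"
      "((\<lambda>\<sigma>. (\<sigma> - 1) * Re (L (Complex \<sigma> t))) \<longlongrightarrow> - real m1) (at_right 1)"
    using ord(2) t by (simp_all add: ord_at_def)
  have m2: "((\<lambda>\<sigma>. (\<sigma> - 1) * Re (L (Complex \<sigma> (2 * t)))) \<longlongrightarrow> - real m2) (at_right 1)"
    using ord(3) t by (simp add: ord_at_def)
  have "m0 = 0" using m0(1) zeta_reg_1 by (simp flip: one_complex.code)
  have "((\<lambda>\<sigma>. 3 * ((\<sigma> - 1) * Re (L (Complex \<sigma> 0))) + 4 * ((\<sigma> - 1) * Re (L (Complex \<sigma> t)))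
            + (\<sigma> - 1) * Re (L (Complex \<sigma> (2 * t)))) \<longlongrightarrow> 3 * (1 - real m0) + 4 * (- real m1) + - real m2) (at_right 1)"
    by (intro tendsto_add tendsto_mult_left m0 m1 m2)
  moreover have ev: "eventually (\<lambda>\<sigma>. 3 * ((\<sigma> - 1) * Re (L (Complex \<sigma> 0))) + 4 * ((\<sigma> - 1) * Re (L (Complex \<sigma> t)))
            + (\<sigma> - 1) * Re (L (Complex \<sigma> (2 * t))) \<ge> 0) (at_right 1)"
  proof -
    have "eventually (\<lambda>\<sigma>::real. \<sigma> > 1) (at_right 1)" by (rule eventually_at_right_less)
    then show ?thesis
    proof eventually_elim
      case (elim \<sigma>)
      have "(\<sigma> - 1) * (3 * Re (L (Complex \<sigma> 0)) + 4 * Re (L (Complex \<sigma> t)) + Re (L (Complex \<sigma> (2 * t)))) \<ge> 0"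
        using elim mertens_inequality[of \<sigma> t] by (intro mult_nonneg_nonneg) (auto simp: L_def)
      then show ?case by (simp add: algebra_simps)
    qed
  qed
  ultimately have "3 * (1 - real m0) + 4 * (- real m1) + - real m2 \<ge> 0"
    by (rule tendsto_lowerbound) simp
  then have "m1 = 0" using \<open>m0 = 0\<close> by simp
  then show ?thesis using m1(1) s by simp
qed


section \<open>Bounds for heads and tails of Dirichlet series\<close>

lemma powr_Suc_diff:
  assumes "m \<ge> 1"
  obtains c where "real m < c" "c < real (Suc m)"
    "real (Suc m) powr w - real m powr w = w * c powr (w - 1)"
proof -
  have "\<exists>c>real m. c < real (Suc m) \<and> real (Suc m) powr w - real m powr w
           = (real (Suc m) - real m) * (w * c powr (w - 1))"
    using assms by (intro MVT2) (auto intro!: derivative_eq_intros)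
  then show ?thesis using that by auto
qed

text \<open>
  Comparison with the integral of \<open>x\<^bsup>y-1\<^esup>\<close> over \<open>[0, N]\<close>. The integrand decreases for \<open>y \<le> 1\<close> and
  then the first summand suffices; for \<open>y > 1\<close> it increases and the last term has to be added.
\<close>

lemma sum_powr_le:
  assumes y: "y > 0"
  shows "(\<Sum>n=1..N. real n powr (y - 1)) \<le> real N powr y / y + real N powr (y - 1)"
proof (cases "y \<le> 1")
  case True
  have "(\<Sum>n=1..N. real n powr (y - 1)) \<le> real N powr y / y"
  proof (induction N)
    case (Suc N)
    have "real N powr y / y + real (Suc N) powr (y - 1) \<le> real (Suc N) powr y / y"
    proof (cases "N = 0")
      case False
      then obtain c where c: "real N < c" "c < real (Suc N)"
        "real (Suc N) powr y - real N powr y = y * c powr (y - 1)"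
        using powr_Suc_diff[of N y] by auto
      have "real (Suc N) powr (y - 1) \<le> c powr (y - 1)"
        using True c by (intro powr_mono2') auto
      also have "\<dots> = (real (Suc N) powr y - real N powr y) / y"
        using c(3) y by simp
      finally show ?thesis by (simp add: diff_divide_distrib)
    qed (use True y in auto)
    then show ?case using Suc.IH by simp
  qed auto
  then show ?thesis by (smt (verit) powr_ge_zero)
next
  case False
  show ?thesis
  proof (induction N)
    case (Suc N)
    have "real N powr y / y + real N powr (y - 1) \<le> real (Suc N) powr y / y"
    proof (cases "N = 0")
      case F: False
      then obtain c where c: "real N < c" "c < real (Suc N)"
        "real (Suc N) powr y - real N powr y = y * c powr (y - 1)"
        using powr_Suc_diff[of N y] by auto
      have "real N powr (y - 1) \<le> c powr (y - 1)"
        using False c by (intro powr_mono2) auto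
      also have "\<dots> = (real (Suc N) powr y - real N powr y) / y"
        using c(3) y by simp
      finally show ?thesis by (simp add: diff_divide_distrib)
    qed (use y in auto)
    then show ?case using Suc.IH by simp
  qed auto
qed

text \<open>
  Comparison of the tail with the integral of \<open>x\<^bsup>-1-Re z\<^esup>\<close> over \<open>[N, \<infinity>)\<close>, carried out as a
  telescoping sum.
\<close>

lemma dirichlet_tail_le:
  assumes a: "\<And>n. norm (a n :: complex) \<le> C" and z: "Re z > 0" and N: "N \<ge> 1"
    and F: "(\<lambda>n. a n * of_nat n powr (-(1 + z))) sums F"
  shows "norm (F - (\<Sum>n=1..N. a n * of_nat n powr (-(1 + z)))) \<le> C * real N powr (- Re z) / Re z"
proof -
  let ?x = "Re z"
  let ?f = "\<lambda>n. a n * of_nat n powr (-(1 + z))"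
  let ?h = "\<lambda>n. C / ?x * (real (n + N) powr (-?x) - real (Suc n + N) powr (-?x))"
  have C: "C \<ge> 0" using a[of 0] norm_ge_zero order_trans by blast
  have "(\<lambda>n. ?f (n + Suc N)) sums (F - (\<Sum>n<Suc N. ?f n))"
    using F by (rule sums_split_initial_segment)
  also have "(\<Sum>n<Suc N. ?f n) = (\<Sum>n=1..N. ?f n)"
    by (intro sum.mono_neutral_right) (auto simp: not_less_eq_eq)
  finally have tail: "(\<lambda>n. ?f (n + Suc N)) sums (F - (\<Sum>n=1..N. ?f n))" .
  have "(\<lambda>n. real (n + N) powr (-?x)) \<longlonglongrightarrow> 0"
    using z by (intro tendsto_neg_powr filterlim_compose[OF filterlim_real_sequentially]
                  filterlim_add_const_nat_at_top) auto
  then have "(\<lambda>n. real (n + N) powr (-?x) - real (Suc n + N) powr (-?x)) sums (real (0 + N) powr (-?x) - 0)"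
    by (rule telescope_sums')
  then have h: "?h sums (C / ?x * (real (0 + N) powr (-?x) - 0))" by (rule sums_mult)
  have "norm (?f (n + Suc N)) \<le> ?h n" for n
  proof -
    obtain c where c: "real (n + N) < c" "c < real (Suc (n + N))"
        "real (Suc (n + N)) powr (-?x) - real (n + N) powr (-?x) = -?x * c powr (-?x - 1)"
      using powr_Suc_diff[of "n + N" "-?x"] N by auto
    have "real (Suc (n + N)) powr (-?x - 1) \<le> c powr (-?x - 1)"
      using z c by (intro powr_mono2') auto
    also have "\<dots> = (real (n + N) powr (-?x) - real (Suc n + N) powr (-?x)) / ?x"
      using c(3) z by (simp add: field_simps)
    finally have "C * real (n + Suc N) powr (-?x - 1) \<le> ?h n"
      using C mult_left_mono by fastforce
    moreover have "Re (-(1 + z)) = -?x - 1" by simp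
    then have "norm (?f (n + Suc N)) \<le> C * real (n + Suc N) powr (-?x - 1)"
      using mult_right_mono[OF a[of "n + Suc N"], of "real (n + Suc N) powr (-?x - 1)"]
      by (simp only: norm_mult norm_nat_powr powr_ge_zero simp_thms)
    ultimately show ?thesis by linarith
  qed
  then have "norm (\<Sum>n. ?f (n + Suc N)) \<le> (\<Sum>n. ?h n)"
    using h by (intro norm_suminf_le) (auto simp: sums_iff)
  then show ?thesis using tail h by (simp add: sums_iff)
qed

lemma dirichlet_head_le:
  assumes a: "\<And>n. norm (a n :: complex) \<le> C" and z: "Re z < 0"
  shows "norm (\<Sum>n=1..N. a n * of_nat n powr (-(1 + z)))
           \<le> C * (real N powr (- Re z) / (- Re z) + real N powr (- Re z - 1))"
proof -
  have C: "C \<ge> 0" using a[of 0] norm_ge_zero order_trans by blast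
  have "norm (\<Sum>n=1..N. a n * of_nat n powr (-(1 + z))) \<le> (\<Sum>n=1..N. C * real n powr (- Re z - 1))"
  proof (rule sum_norm_le)
    fix n
    have "Re (-(1 + z)) = - Re z - 1" by simp
    then show "norm (a n * of_nat n powr (-(1 + z))) \<le> C * real n powr (- Re z - 1)"
      using mult_right_mono[OF a[of n], of "real n powr (- Re z - 1)"]
      by (simp only: norm_mult norm_nat_powr powr_ge_zero simp_thms)
  qed
  also have "\<dots> = C * (\<Sum>n=1..N. real n powr (- Re z - 1))" by (simp add: sum_distrib_left)
  also have "\<dots> \<le> C * (real N powr (- Re z) / (- Re z) + real N powr (- Re z - 1))"
    using z C by (intro mult_left_mono sum_powr_le) auto
  finally show ?thesis .
qed


section \<open>Newman's Tauberian theorem\<close>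

lemma continuous_on_nat_powr: "continuous_on A (\<lambda>z. of_nat N powr z :: complex)"
  by (cases "N = 0") (auto intro!: continuous_intros)

text \<open>
  In the open left half-plane \<open>N\<^sup>z\<close> tends to \<open>0\<close>, but not uniformly if an endpoint of the segment
  lies on the imaginary axis. As \<open>|N\<^sup>z| \<le> 1\<close> there, dominated convergence replaces uniformity.
\<close>

lemma contour_integral_linepath_powr_tendsto_0:
  assumes \<phi>: "continuous_on (closed_segment a b) \<phi>"
    and neg: "\<And>x. 0 < x \<Longrightarrow> x < 1 \<Longrightarrow> Re (linepath a b x) < 0"
  shows "(\<lambda>N. contour_integral (linepath a b) (\<lambda>z. \<phi> z * of_nat N powr z)) \<longlonglongrightarrow> 0"
proof -
  let ?f = "\<lambda>N x. \<phi> (linepath a b x) * of_nat N powr (linepath a b x) * (b - a)"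
  have "compact (\<phi> ` closed_segment a b)"
    using \<phi> by (intro compact_continuous_image) auto
  then obtain B where B: "\<And>z. z \<in> closed_segment a b \<Longrightarrow> norm (\<phi> z) \<le> B"
    by (meson bounded_iff compact_imp_bounded imageI)
  have seg: "linepath a b x \<in> closed_segment a b" if "x \<in> {0..1}" for x
    using that by (auto simp: closed_segment_def linepath_def)
  have cont: "continuous_on {0..1} (?f N)" for N
  proof -
    have "continuous_on {0..1} (\<lambda>x. \<phi> (linepath a b x))"
      by (rule continuous_on_compose2[OF \<phi>]) (use seg in \<open>auto intro!: continuous_intros\<close>)
    moreover have "continuous_on {0..1} (\<lambda>x. of_nat N powr (linepath a b x) :: complex)"
      by (rule continuous_on_compose2[OF continuous_on_nat_powr]) (auto intro!: continuous_intros)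
    ultimately show ?thesis by (intro continuous_on_mult continuous_on_const)
  qed
  have "(\<lambda>N. integral {0<..<1} (?f N)) \<longlonglongrightarrow> integral {0<..<1::real} (\<lambda>_. 0)"
  proof (rule dominated_convergence(2)[where f = ?f and h = "\<lambda>_. B * norm (b - a)" and g = "\<lambda>_. 0"])
    fix N
    show "?f N integrable_on {0<..<1}"
      using integrable_continuous_real[OF cont] by (simp add: integrable_on_open_interval_real)
    show "(\<lambda>_. B * norm (b - a)) integrable_on {0<..<1::real}"
      using integrable_continuous_real[of 0 1 "\<lambda>_. B * norm (b - a)"] by (simp add: integrable_on_open_interval_real)
    fix x :: real assume x: "x \<in> {0<..<1}"
    have "real N powr Re (linepath a b x) \<le> 1"
    proof (cases "N = 0")
      case False
      then have "real N powr Re (linepath a b x) \<le> real N powr 0"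
        using neg[of x] x by (intro powr_mono) auto
      then show ?thesis using False by simp
    qed auto
    then have "norm (\<phi> (linepath a b x)) * real N powr Re (linepath a b x) \<le> B * 1"
      using B[OF seg[of x]] x by (intro mult_mono) (auto intro: order_trans[OF norm_ge_zero])
    then show "norm (?f N x) \<le> B * norm (b - a)"
      by (simp add: norm_mult norm_nat_powr mult_right_mono)
  next
    fix x :: real assume x: "x \<in> {0<..<1}"
    have "(\<lambda>N. of_nat N powr (linepath a b x) :: complex) \<longlonglongrightarrow> 0"
    proof (rule tendsto_norm_zero_cancel)
      show "(\<lambda>N. norm (of_nat N powr (linepath a b x) :: complex)) \<longlonglongrightarrow> 0"
        unfolding norm_nat_powr using neg[of x] x
        by (intro tendsto_neg_powr filterlim_real_sequentially) auto
    qed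
    then have "(\<lambda>N. ?f N x) \<longlonglongrightarrow> \<phi> (linepath a b x) * 0 * (b - a)"
      by (intro tendsto_intros)
    then show "(\<lambda>N. ?f N x) \<longlonglongrightarrow> 0" by simp
  qed
  moreover have "contour_integral (linepath a b) (\<lambda>z. \<phi> z * of_nat N powr z) = integral {0<..<1} (?f N)" for N
    by (simp add: contour_integral_integral integral_open_interval_real)
  ultimately show ?thesis by simp
qed

text \<open>
  Cauchy's integral formula for the circle cut at \<open>-iR\<close> and \<open>iR\<close>, because the integrand is
  estimated differently on its right and left halves.
\<close>

lemma half_circles_integral:
  assumes G: "G holomorphic_on UNIV" and R: "R > 0"
  shows "contour_integral (part_circlepath 0 R (-(pi/2)) (pi/2)) (\<lambda>z. G z / z)
       + contour_integral (part_circlepath 0 R (pi/2) (3*pi/2)) (\<lambda>z. G z / z) = 2 * pi * \<i> * G 0"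
proof -
  let ?A = "part_circlepath 0 R (-(pi/2)) (pi/2)" and ?B = "part_circlepath 0 R (pi/2) (3*pi/2)"
  have sphere: "path_image (part_circlepath 0 R s t) \<subseteq> sphere 0 R" if "s \<le> t" for s t
    using that R by (intro path_image_part_circlepath_subset) auto
  have nz: "0 \<notin> path_image ?A" "0 \<notin> path_image ?B"
    using sphere[of "-(pi/2)" "pi/2"] sphere[of "pi/2" "3*pi/2"] R by auto
  have wn: "winding_number (part_circlepath 0 R s t) 0 = (t - s) / (2 * pi)" if "s < t" for s t
  proof -
    have "0 \<notin> path_image (part_circlepath 0 R s t)" using sphere[of s t] that R by auto
    then have "winding_number (part_circlepath 0 R s t) 0
        = 1 / (2 * pi * \<i>) * contour_integral (part_circlepath 0 R s t) (\<lambda>w. 1 / (w - 0))"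
      by (intro winding_number_valid_path) auto
    also have "contour_integral (part_circlepath 0 R s t) (\<lambda>w. 1 / (w - 0)) = integral {s..t} (\<lambda>x. \<i>)"
      using R that by (subst contour_integral_part_circlepath_eq) auto
    also have "\<dots> = (t - s) * \<i>" using that by (simp add: scaleR_conv_of_real)
    finally show ?thesis by simp
  qed
  have join: "pathfinish ?A = pathstart ?B" by simp
  have "\<i> * (3 * complex_of_real pi) / 2 = - (\<i> * complex_of_real pi / 2) + 2 * complex_of_real pi * \<i>"
    by (simp add: field_simps)
  then have "exp (\<i> * (3 * complex_of_real pi) / 2) = exp (- (\<i> * complex_of_real pi / 2))"
    by (simp only: exp_add exp_two_pi_i mult_1_right)
  then have closed: "pathfinish (?A +++ ?B) = pathstart (?A +++ ?B)" by simp
  have "winding_number (?A +++ ?B) 0 = 1"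
    using nz join by (subst winding_number_join) (auto simp: wn simp flip: of_real_add)
  then have "((\<lambda>w. G w / (w - 0)) has_contour_integral 2 * pi * \<i> * G 0) (?A +++ ?B)"
    using Cauchy_integral_formula_convex_simple[of UNIV G 0 "?A +++ ?B"] G nz closed join
    by (auto simp: path_image_join)
  then have "contour_integral (?A +++ ?B) (\<lambda>w. G w / w) = 2 * pi * \<i> * G 0"
    by (simp add: contour_integral_unique)
  moreover have "(\<lambda>w. G w / w) contour_integrable_on ?A" "(\<lambda>w. G w / w) contour_integrable_on ?B"
    using nz holomorphic_on_imp_continuous_on[OF G]
    by (auto intro!: contour_integrable_continuous_part_circlepath continuous_on_divide
           intro: continuous_on_subset)
  ultimately show ?thesis by (simp add: contour_integral_join join)
qed

text \<open>
  The reason for Newman's kernel: on the circle it equals \<open>2 Re z / R\<^sup>2\<close>, and this zero at the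
  imaginary axis absorbs the factor \<open>1 / |Re z|\<close> in the bounds for heads and tails.
\<close>

lemma newman_kernel:
  assumes "norm z = R" "R > 0"
  shows "(1 + z ^ 2 / of_real (R ^ 2)) / z = of_real (2 * Re z / R ^ 2)"
proof -
  have zz: "of_real (R ^ 2) = z * cnj z" by (metis assms(1) complex_norm_square)
  have nz: "z \<noteq> 0" "cnj z \<noteq> 0" using assms by auto
  have "(1 + z ^ 2 / of_real (R ^ 2)) / z = (cnj z + z) / of_real (R ^ 2)"
    unfolding zz using nz by (simp add: field_simps power2_eq_square)
  also have "cnj z + z = of_real (2 * Re z)" by (simp add: complex_add_cnj add.commute)
  finally show ?thesis by simp
qed

lemma Re_eq_0_sphere:
  assumes "norm z = R" "Re z = 0"
  shows "z \<in> {\<i> * of_real R, - \<i> * of_real R}"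
proof -
  have "\<bar>Im z\<bar> = R" using assms by (simp add: cmod_def)
  then show ?thesis using assms by (auto simp: complex_eq_iff)
qed

text \<open>
  Newman's theorem for a Dirichlet series whose continuation vanishes at \<open>1\<close>; writing the sum as
  \<open>z H(z)\<close> puts this zero in evidence and spares a residue at \<open>0\<close>. Changing the first coefficient
  reduces any other value at \<open>1\<close> to this case.

  Let \<open>S\<^sub>N\<close> be the partial sum and \<open>K\<^sub>N(z) = N\<^sup>z (1 + z\<^sup>2 / R\<^sup>2)\<close>. Cauchy's formula represents
  \<open>2\<pi>i S\<^sub>N(0)\<close> by the integral of \<open>S\<^sub>N K\<^sub>N / z\<close> over the circle of radius \<open>R\<close>, while the integral of
  \<open>H K\<^sub>N\<close> over the right half circle, closed up by a path slightly to the left of the imaginary axis,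
  is \<open>0\<close>. Subtracting leaves three parts: the tail of the series on the right half circle, and
  \<open>S\<^sub>N\<close> on the left half circle, both of size \<open>O(1 / R + 1 / N)\<close> by the choice of the kernel, and the integral
  of \<open>H K\<^sub>N\<close> over the left path, which tends to \<open>0\<close> with \<open>N\<close>. Since \<open>R\<close> is arbitrary, \<open>S\<^sub>N(0)\<close>
  tends to \<open>0\<close>.
\<close>

lemma newman_tauberian:
  fixes a :: "nat \<Rightarrow> complex" and H :: "complex \<Rightarrow> complex"
  assumes a: "\<And>n. norm (a n) \<le> C"
    and U: "open U" "{z. Re z \<ge> 0} \<subseteq> U" and H: "H holomorphic_on U"
    and series: "\<And>z. Re z > 0 \<Longrightarrow> (\<lambda>n. a n * of_nat n powr (-(1 + z))) sums (z * H z)"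
  shows "(\<lambda>N. \<Sum>n=1..N. a n / of_nat n) \<longlonglongrightarrow> 0"
proof -
  define S where "S = (\<lambda>N z. \<Sum>n=1..N. a n * of_nat n powr (-(1 + z)))"
  have C: "C \<ge> 0" using a[of 0] norm_ge_zero order_trans by blast
  have S_hol: "S N holomorphic_on A" for N A
    unfolding S_def by (intro holomorphic_intros) auto
  have S0: "S N 0 = (\<Sum>n=1..N. a n / of_nat n)" for N
    unfolding S_def by (intro sum.cong) (auto simp: powr_minus divide_inverse)
  have bound: "\<exists>E. E \<longlonglongrightarrow> 0 \<and> (\<forall>N\<ge>1. norm (S N 0) \<le> 2 * C / R + C / N + norm (E N :: complex))"
    if R: "R > 0" for R :: real
  proof -
    define K where "K = (\<lambda>N z. of_nat N powr z * (1 + z ^ 2 / of_real (R ^ 2)) :: complex)"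
    let ?A = "part_circlepath 0 R (-(pi/2)) (pi/2)" and ?B = "part_circlepath 0 R (pi/2) (3*pi/2)"
    have K_hol: "K N holomorphic_on A" if "N \<ge> 1" for N A
      unfolding K_def using R that by (intro holomorphic_intros) auto
    have K0: "K N 0 = 1" if "N \<ge> 1" for N using that by (simp add: K_def)
    have K_norm: "norm (K N z / z) = real N powr Re z * (2 * \<bar>Re z\<bar> / R ^ 2)" if "norm z = R" for N z
    proof -
      have "K N z / z = of_nat N powr z * of_real (2 * Re z / R ^ 2)"
        unfolding K_def newman_kernel[OF that R, symmetric] by simp
      then show ?thesis by (simp add: norm_mult norm_divide norm_nat_powr abs_mult del: of_real_divide of_real_mult)
    qed
    have A_pt: "norm z = R \<and> Re z \<ge> 0" if "z \<in> path_image ?A" for z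
      using that R by (auto simp: path_image_part_circlepath norm_mult Re_exp cos_ge_zero)
    have B_pt: "norm z = R \<and> Re z \<le> 0" if "z \<in> path_image ?B" for z
    proof -
      obtain x where x: "z = of_real R * exp (\<i> * of_real x)" "pi / 2 \<le> x" "x \<le> 3 * pi / 2"
        using \<open>z \<in> path_image ?B\<close> by (auto simp: path_image_part_circlepath)
      have "cos (x - pi) \<ge> 0" using x by (intro cos_ge_zero) auto
      then have "cos x \<le> 0" by (simp add: cos_diff)
      then show ?thesis using x R by (simp add: norm_mult Re_exp mult_nonneg_nonpos)
    qed
    \<comment> \<open>A convex neighbourhood \<open>V\<close> of the closed right half disc inside \<open>U\<close>: by compactness \<open>U\<close> reaches
      a fixed distance \<open>\<epsilon>\<close> to the left of the segment from \<open>-i(R+1)\<close> to \<open>i(R+1)\<close>.\<close>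
    have "compact ((\<lambda>t. Complex 0 t) ` {-(R+1)..R+1})"
      by (intro compact_continuous_image continuous_intros) auto
    moreover have "(\<lambda>t. Complex 0 t) ` {-(R+1)..R+1} \<subseteq> U" using U by auto
    ultimately obtain \<epsilon> where \<epsilon>: "\<epsilon> > 0" "(\<Union>x\<in>(\<lambda>t. Complex 0 t) ` {-(R+1)..R+1}. ball x \<epsilon>) \<subseteq> U"
      using U(1) by (auto elim: compact_subset_open_imp_ball_epsilon_subset)
    define V where "V = {z. Re z > -\<epsilon>} \<inter> ({z. Im z > -(R+1)} \<inter> {z. Im z < R+1})"
    have V: "convex V" unfolding V_def
      by (intro convex_Int convex_halfspace_Re_gt convex_halfspace_Im_gt convex_halfspace_Im_lt)
    have "V \<subseteq> U"
    proof
      fix z assume z: "z \<in> V"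
      show "z \<in> U"
      proof (cases "Re z \<ge> 0")
        case False
        have "z - Complex 0 (Im z) = of_real (Re z)" by (simp add: complex_eq_iff)
        then have "z \<in> ball (Complex 0 (Im z)) \<epsilon>"
          using False z by (simp add: dist_norm norm_minus_commute V_def)
        moreover have "Im z \<in> {-(R+1)..R+1}" using z by (simp add: V_def)
        ultimately show ?thesis using \<epsilon>(2) by blast
      qed (use U in auto)
    qed
    then have H_hol: "H holomorphic_on V" using H holomorphic_on_subset by blast
    \<comment> \<open>The left path runs from \<open>p\<close> through the point \<open>q\<close> of the open left half-plane to \<open>-p\<close>.\<close>
    define p q :: complex where "p = \<i> * of_real R" and "q = - of_real (\<epsilon> / 2)"
    define \<phi> where "\<phi> = (\<lambda>z. H z * (1 + z ^ 2 / of_real (R ^ 2)))"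
    have \<phi>_hol: "\<phi> holomorphic_on V"
      unfolding \<phi>_def using R by (intro holomorphic_intros H_hol) auto
    have pq: "p \<in> V" "q \<in> V" "-p \<in> V" using R \<epsilon> by (auto simp: V_def p_def q_def)
    have segs: "closed_segment p q \<subseteq> V" "closed_segment q (-p) \<subseteq> V"
      using pq V closed_segment_subset by blast+
    define E where "E = (\<lambda>N. contour_integral (linepath p q) (\<lambda>z. \<phi> z * of_nat N powr z)
                         + contour_integral (linepath q (-p)) (\<lambda>z. \<phi> z * of_nat N powr z))"
    have \<phi>_cont: "continuous_on A \<phi>" if "A \<subseteq> V" for A
      using \<phi>_hol holomorphic_on_imp_continuous_on continuous_on_subset that by blast
    have "E \<longlonglongrightarrow> 0 + 0"
      unfolding E_def
      by (intro tendsto_add contour_integral_linepath_powr_tendsto_0 \<phi>_cont segs)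
         (use \<epsilon> in \<open>auto simp: linepath_def p_def q_def\<close>)
    then have E: "E \<longlonglongrightarrow> 0" by simp
    have "norm (S N 0) \<le> 2 * C / R + C / N + norm (E N)" if N: "N \<ge> 1" for N
    proof -
      have startA: "pathstart ?A = -p" "pathfinish ?A = p"
      proof -
        have e: "exp (\<i> * complex_of_real (-(pi/2))) = -\<i>" "exp (\<i> * complex_of_real (pi/2)) = \<i>"
          unfolding cis_conv_exp[symmetric] by (simp_all add: complex_eq_iff)
        show "pathstart ?A = -p" "pathfinish ?A = p"
          unfolding pathstart_part_circlepath pathfinish_part_circlepath e by (simp_all add: p_def)
      qed
      have A_V: "path_image ?A \<subseteq> V"
      proof
        fix z assume "z \<in> path_image ?A"
        then have "norm z = R" "Re z \<ge> 0" using A_pt by auto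
        then show "z \<in> V" using abs_Im_le_cmod[of z] \<epsilon> by (auto simp: V_def)
      qed
      let ?f = "\<lambda>z. \<phi> z * of_nat N powr z"
      have f_hol: "?f holomorphic_on V"
        using N by (intro holomorphic_intros \<phi>_hol) auto
      have f_cont: "continuous_on A ?f" if "A \<subseteq> V" for A
        using f_hol holomorphic_on_imp_continuous_on continuous_on_subset that by blast
      have intA: "?f contour_integrable_on ?A"
        using A_V by (intro contour_integrable_continuous_part_circlepath f_cont)
      have intl: "?f contour_integrable_on linepath p q" "?f contour_integrable_on linepath q (-p)"
        using segs by (auto intro!: contour_integrable_continuous_linepath f_cont)
      have "(?f has_contour_integral 0) (?A +++ (linepath p q +++ linepath q (-p)))"
        using V f_hol A_V segs
        by (intro Cauchy_theorem_convex_simple[of _ V]) (auto simp: startA path_image_join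
               simp del: pathstart_part_circlepath pathfinish_part_circlepath)
      from contour_integral_unique[OF this] have left: "contour_integral ?A ?f + E N = 0"
        using intA intl by (simp add: E_def
               del: pathstart_part_circlepath pathfinish_part_circlepath)
      let ?g = "\<lambda>z. S N z * K N z / z"
      have g_cont: "continuous_on A ?g" if "\<And>z. z \<in> A \<Longrightarrow> norm z = R" for A
        using that R N holomorphic_on_imp_continuous_on[OF S_hol[of N A]]
          holomorphic_on_imp_continuous_on[OF K_hol[of N A]]
        by (intro continuous_intros) force+
      have intgA: "?g contour_integrable_on ?A" and intgB: "?g contour_integrable_on ?B"
        using A_pt B_pt by (auto intro!: contour_integrable_continuous_part_circlepath g_cont)
      have cauchy: "contour_integral ?A ?g + contour_integral ?B ?g = 2 * pi * \<i> * S N 0"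
        using half_circles_integral[OF holomorphic_on_mult[OF S_hol K_hol[OF N]] R] K0[OF N] by simp
      \<comment> \<open>At the endpoints \<open>p\<close> and \<open>-p\<close> of the half circles the real part is \<open>0\<close> and neither series bound
        applies; two points do not affect the integrals.\<close>
      have boundA: "norm (contour_integral ?A (\<lambda>z. ?g z - ?f z)) \<le> 2 * C / R ^ 2 * R * (pi / 2 - (-(pi / 2)))"
      proof (rule contour_integral_bound_part_circlepath_strong[where k = "{p, -p}"])
        show "(\<lambda>z. ?g z - ?f z) contour_integrable_on ?A"
          using intgA intA by (rule contour_integrable_diff)
        fix z assume z: "z \<in> path_image ?A - {p, -p}"
        then have nz: "norm z = R" and "Re z \<noteq> 0"
          using A_pt[of z] Re_eq_0_sphere[of z R] by (auto simp: p_def)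
        then have Re: "Re z > 0" using A_pt[of z] z by auto
        have "z \<noteq> 0" using nz R by auto
        moreover have "?f z = H z * K N z" by (simp add: \<phi>_def K_def)
        ultimately have "?g z - ?f z = - ((z * H z - S N z) * (K N z / z))"
          by (simp add: field_simps)
        also have "norm \<dots> = norm (z * H z - S N z) * (real N powr Re z * (2 * Re z / R ^ 2))"
          using Re by (simp only: norm_minus_cancel norm_mult[of "_ - _"] K_norm[OF nz] abs_of_pos)
        also have "\<dots> \<le> (C * real N powr (- Re z) / Re z) * (real N powr Re z * (2 * Re z / R ^ 2))"
          unfolding S_def using dirichlet_tail_le[where a = a, OF a Re N series[OF Re]] Re
          by (intro mult_right_mono) auto
        also have "\<dots> = 2 * C / R ^ 2"
          using Re N by (simp add: powr_minus field_simps)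
        finally show "norm (?g z - ?f z) \<le> 2 * C / R ^ 2" .
      qed (use R C in auto)
      have boundB: "norm (contour_integral ?B ?g) \<le> C * (2 / R ^ 2 + 2 / (N * R)) * R * (3 * pi / 2 - pi / 2)"
      proof (rule contour_integral_bound_part_circlepath_strong[where k = "{p, -p}"])
        fix z assume z: "z \<in> path_image ?B - {p, -p}"
        then have nz: "norm z = R" and "Re z \<noteq> 0"
          using B_pt[of z] Re_eq_0_sphere[of z R] by (auto simp: p_def)
        then have Re: "Re z < 0" using B_pt[of z] z by auto
        define y where "y = - Re z"
        have y: "y > 0" "y \<le> R" using Re nz abs_Re_le_cmod[of z] by (auto simp: y_def)
        have head: "norm (S N z) \<le> C * (real N powr y / y + real N powr (y - 1))"
          unfolding S_def y_def by (rule dirichlet_head_le[where a = a, OF a Re])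
        have "norm (?g z) = norm (S N z) * (real N powr Re z * (2 * \<bar>Re z\<bar> / R ^ 2))"
          by (simp only: times_divide_eq_right[symmetric] norm_mult[of "S N z"] K_norm[OF nz])
        also have "\<dots> = norm (S N z) * (real N powr (-y) * (2 * y / R ^ 2))"
          using Re by (simp add: y_def)
        also have "\<dots> \<le> (C * (real N powr y / y + real N powr (y - 1))) * (real N powr (-y) * (2 * y / R ^ 2))"
          by (intro mult_right_mono head) (use y in simp)
        also have "\<dots> = C * (2 / R ^ 2 + 2 * y / (N * R ^ 2))"
        proof -
          define P where "P = real N powr y"
          have P: "P > 0" "real N powr (-y) = 1 / P" "real N powr (y - 1) = P / N"
            using N by (simp_all add: P_def powr_minus powr_diff inverse_eq_divide)
          have "P / y * (1 / P * (2 * y / R ^ 2)) = 2 / R ^ 2" using P(1) y by simp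
          moreover have "P / N * (1 / P * (2 * y / R ^ 2)) = 2 * y / (N * R ^ 2)" using P(1) by simp
          ultimately have "(P / y + P / N) * (1 / P * (2 * y / R ^ 2)) = 2 / R ^ 2 + 2 * y / (N * R ^ 2)"
            by (simp only: distrib_right)
          then show ?thesis unfolding P(2,3) P_def[symmetric] by (simp only: mult.assoc)
        qed
        also have "2 * y / (N * R ^ 2) \<le> 2 * R / (N * R ^ 2)"
          using y by (intro divide_right_mono) auto
        also have "2 * R / (N * R ^ 2) = 2 / (N * R)"
          using R by (simp add: power2_eq_square)
        finally show "norm (?g z) \<le> C * (2 / R ^ 2 + 2 / (N * R))"
          using C by (simp add: mult_left_mono)
      qed (use R C N intgB in auto)
      have tri: "norm (x + y - w) \<le> norm x + norm y + norm w" for x y w :: complex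
        using norm_triangle_ineq4[of "x + y" w] norm_triangle_ineq[of x y] by linarith
      have "2 * pi * \<i> * S N 0
              = (contour_integral ?A ?g + contour_integral ?B ?g) - (contour_integral ?A ?f + E N)"
        by (simp only: cauchy left diff_0_right)
      also have "\<dots> = contour_integral ?A (\<lambda>z. ?g z - ?f z) + contour_integral ?B ?g - E N"
        unfolding contour_integral_diff[OF intgA intA] by simp
      finally have "norm (2 * pi * \<i> * S N 0) \<le> norm (contour_integral ?A (\<lambda>z. ?g z - ?f z))
                    + norm (contour_integral ?B ?g) + norm (E N)"
        by (simp only: tri)
      also have "norm (2 * pi * \<i> * S N 0) = 2 * pi * norm (S N 0)" by (simp add: norm_mult)
      finally have "2 * pi * norm (S N 0) \<le> 2 * C / R ^ 2 * R * (pi / 2 - (-(pi / 2)))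
             + C * (2 / R ^ 2 + 2 / (N * R)) * R * (3 * pi / 2 - pi / 2) + norm (E N)"
        using boundA boundB by linarith
      also have "2 * C / R ^ 2 * R = 2 * C / R"
        using R by (simp add: power2_eq_square)
      also have "C * (2 / R ^ 2 + 2 / (N * R)) * R = 2 * C / R + 2 * C / N"
        using R by (simp add: power2_eq_square distrib_left distrib_right mult.commute)
      also have "2 * C / R * (pi / 2 - (-(pi / 2))) + (2 * C / R + 2 * C / N) * (3 * pi / 2 - pi / 2) + norm (E N)
          = 2 * pi * (2 * C / R + C / N) + norm (E N)"
        by (simp add: algebra_simps)
      also have "\<dots> \<le> 2 * pi * (2 * C / R + C / N) + 2 * pi * norm (E N)"
        using pi_gt3 mult_right_mono[of 1 "2 * pi" "norm (E N)"] by simp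
      finally have "2 * pi * norm (S N 0) \<le> 2 * pi * (2 * C / R + C / N + norm (E N))"
        by (simp add: algebra_simps)
      then show ?thesis using pi_gt_zero by simp
    qed
    then show ?thesis using E by blast
  qed
  have "(\<lambda>N. S N 0) \<longlonglongrightarrow> 0"
  proof (rule LIMSEQ_I)
    fix e :: real assume e: "e > 0"
    \<comment> \<open>This makes \<open>2 * C / R\<close> at most \<open>e / 2\<close>; the summand \<open>1\<close> keeps \<open>R\<close> positive if \<open>C = 0\<close>.\<close>
    define R where "R = 4 * (C + 1) / e"
    have R: "R > 0" using e C by (simp add: R_def)
    obtain E :: "nat \<Rightarrow> complex" where E: "E \<longlonglongrightarrow> 0"
      "\<And>N. N \<ge> 1 \<Longrightarrow> norm (S N 0) \<le> 2 * C / R + C / N + norm (E N)"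
      using bound[OF R] by blast
    have "2 * C / R = e / 2 * (C / (C + 1))" using C e by (simp add: R_def field_simps)
    also have "\<dots> \<le> e / 2 * 1" using C e by (intro mult_left_mono) auto
    finally have CR: "2 * C / R \<le> e / 2" by simp
    have "(\<lambda>N. C / real N + norm (E N)) \<longlonglongrightarrow> 0 + norm (0 :: complex)"
      by (intro tendsto_add tendsto_norm E(1) lim_const_over_n)
    then have "eventually (\<lambda>N. C / real N + norm (E N) < e / 2) sequentially"
      using e by (intro order_tendstoD(2)) auto
    then obtain N0 where N0: "\<And>N. N \<ge> N0 \<Longrightarrow> C / real N + norm (E N) < e / 2"
      by (auto simp: eventually_sequentially)
    show "\<exists>no. \<forall>n\<ge>no. norm (S n 0 - 0) < e"
    proof (intro exI[of _ "max 1 N0"] allI impI)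
      fix n assume n: "n \<ge> max 1 N0"
      have "norm (S n 0) \<le> 2 * C / R + C / n + norm (E n)" using n by (intro E(2)) simp
      moreover have "C / n + norm (E n) < e / 2" using n by (intro N0) simp
      ultimately show "norm (S n 0 - 0) < e" unfolding diff_0_right using CR by linarith
    qed
  qed
  then show ?thesis by (simp add: S0)
qed


section \<open>From convergent series to mean values\<close>

lemma cesaro_mean_tendsto_0:
  fixes x :: "nat \<Rightarrow> real"
  assumes "x \<longlonglongrightarrow> 0"
  shows "(\<lambda>N. (\<Sum>n<N. x n) / real N) \<longlonglongrightarrow> 0"
proof (rule LIMSEQ_I)
  fix e :: real assume e: "e > 0"
  obtain N0 where N0: "\<And>n. n \<ge> N0 \<Longrightarrow> \<bar>x n\<bar> < e / 2"
    using LIMSEQ_D[OF assms, of "e / 2"] e by auto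
  define K where "K = (\<Sum>n<N0. \<bar>x n\<bar>)"
  have "(\<lambda>N. K / real N) \<longlonglongrightarrow> 0" by (rule lim_const_over_n)
  then obtain N1 where N1: "\<And>N. N \<ge> N1 \<Longrightarrow> K / real N < e / 2"
    using order_tendstoD(2)[of "\<lambda>N. K / real N" 0 sequentially "e / 2"] e
    by (auto simp: eventually_sequentially)
  show "\<exists>no. \<forall>N\<ge>no. norm ((\<Sum>n<N. x n) / real N - 0) < e"
  proof (intro exI[of _ "max 1 (max N0 N1)"] allI impI)
    fix N assume N: "N \<ge> max 1 (max N0 N1)"
    have "\<bar>\<Sum>n<N. x n\<bar> \<le> (\<Sum>n<N. \<bar>x n\<bar>)" by (rule sum_abs)
    also have "\<dots> = K + (\<Sum>n=N0..<N. \<bar>x n\<bar>)"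
      unfolding K_def using N sum.atLeastLessThan_concat[of 0 N0 N "\<lambda>n. \<bar>x n\<bar>"]
      by (simp add: atLeast0LessThan)
    also have "(\<Sum>n=N0..<N. \<bar>x n\<bar>) \<le> (\<Sum>n=N0..<N. e / 2)"
      using N0 by (intro sum_mono) (auto intro: less_imp_le)
    also have "\<dots> \<le> real N * (e / 2)" using e by (simp add: mult_right_mono)
    finally have "\<bar>\<Sum>n<N. x n\<bar> / real N \<le> (K + real N * (e / 2)) / real N"
      by (intro divide_right_mono) auto
    also have "\<dots> = K / real N + e / 2" using N by (simp add: add_divide_distrib)
    also have "K / real N < e / 2" using N by (intro N1) simp
    finally show "norm ((\<Sum>n<N. x n) / real N - 0) < e" by (simp add: abs_divide)
  qed
qed

text \<open>
  Summation by parts expresses the mean as the difference between a partial sum of the convergent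
  series and the average of all earlier ones; both tend to \<open>L\<close>.
\<close>

lemma kronecker_mean_tendsto_0:
  fixes c :: "nat \<Rightarrow> real"
  assumes "(\<lambda>N. \<Sum>n=1..N. c n / real n) \<longlonglongrightarrow> L"
  shows "(\<lambda>N. (\<Sum>n=1..N. c n) / real N) \<longlonglongrightarrow> 0"
proof -
  define X where "X = (\<lambda>N. \<Sum>n=1..N. c n / real n)"
  have abel: "(\<Sum>n=1..N. c n) = real N * X N - (\<Sum>n<N. X n)" for N
  proof (induction N)
    case (Suc N)
    have "real (Suc N) * X (Suc N) = real (Suc N) * X N + c (Suc N)"
      unfolding X_def by (simp add: distrib_left del: of_nat_Suc)
    then show ?case using Suc.IH by (simp add: algebra_simps)
  qed simp
  have lim: "(\<lambda>N. X N - L) \<longlonglongrightarrow> 0"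
    using assms by (simp add: X_def LIM_zero)
  have "(\<lambda>N. (X N - L) - (\<Sum>n<N. X n - L) / real N) \<longlonglongrightarrow> 0 - 0"
    by (intro tendsto_diff lim cesaro_mean_tendsto_0)
  moreover have "eventually (\<lambda>N. (X N - L) - (\<Sum>n<N. X n - L) / real N = (\<Sum>n=1..N. c n) / real N) sequentially"
    using eventually_gt_at_top[of 0]
  proof eventually_elim
    case (elim N)
    then show ?case
      by (simp only: abel) (simp add: sum_subtractf diff_divide_distrib)
  qed
  ultimately show ?thesis using Lim_transform_eventually by fastforce
qed

text \<open>
  With \<open>s = 1 + z\<close> the Dirichlet series of \<open>\<mu>\<close> is \<open>z / Z(1 + z)\<close> for \<open>Z(s) = (s - 1) \<zeta>(s)\<close>, and
  \<open>1 / Z(1 + z)\<close> is holomorphic near the closed right half-plane because \<open>Z\<close> has no zeros there.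
\<close>

lemma moebius_mean_tendsto_0:
  "(\<lambda>N. real_of_int (\<Sum>n=1..N. moebius n) / real N) \<longlonglongrightarrow> 0"
proof -
  define U where "U = {z. Re z > -1} \<inter> (\<lambda>z. zeta_reg (1 + z)) -` (- {0})"
  have hol: "(\<lambda>z. zeta_reg (1 + z)) holomorphic_on {z. Re z > -1}"
    by (rule holomorphic_on_compose_gen[OF _ holomorphic_zeta_reg, unfolded o_def])
       (auto intro!: holomorphic_intros)
  have "(\<lambda>N. \<Sum>n=1..N. of_int (moebius n) / of_nat n :: complex) \<longlonglongrightarrow> 0"
  proof (rule newman_tauberian[where C = 1 and U = U and H = "\<lambda>z. 1 / zeta_reg (1 + z)"])
    show "norm (of_int (moebius n) :: complex) \<le> 1" for n by (simp add: moebius_def)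
    show "open U"
      unfolding U_def using hol open_halfspace_Re_gt
      by (intro continuous_open_preimage holomorphic_on_imp_continuous_on) auto
    show "{z. Re z \<ge> 0} \<subseteq> U" using zeta_reg_nonzero by (auto simp: U_def)
    show "(\<lambda>z. 1 / zeta_reg (1 + z)) holomorphic_on U"
      by (intro holomorphic_on_divide holomorphic_on_const holomorphic_on_subset[OF hol])
         (auto simp: U_def)
    fix z assume "Re z > 0"
    then show "(\<lambda>n. of_int (moebius n) * of_nat n powr (-(1 + z))) sums (z * (1 / zeta_reg (1 + z)))"
      using sums_moebius[of "1 + z"] by simp
  qed
  then have "(\<lambda>N. complex_of_real (\<Sum>n=1..N. real_of_int (moebius n) / real n)) \<longlonglongrightarrow> of_real 0"
    by (simp add: of_real_sum)
  then have "(\<lambda>N. \<Sum>n=1..N. real_of_int (moebius n) / real n) \<longlonglongrightarrow> 0"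
    by (simp only: tendsto_of_real_iff)
  then show ?thesis
    unfolding of_int_sum by (rule kronecker_mean_tendsto_0)
qed


section \<open>From the Moebius function to the Liouville function\<close>

lemma sum_liouville_eq:
  "(\<Sum>n=1..N. liouville n) = (\<Sum>d=1..N. \<Sum>k=1..N div d ^ 2. moebius k)"
proof -
  have "(\<Sum>n=1..N. liouville n) = (\<Sum>n=1..N. \<Sum>d | d ^ 2 dvd n. moebius (n div d ^ 2))"
    by (intro sum.cong liouville_eq_sum_moebius) auto
  also have "\<dots> = (\<Sum>(n, d)\<in>Sigma {1..N} (\<lambda>n. {d. d ^ 2 dvd n}). moebius (n div d ^ 2))"
  proof (rule sum.Sigma)
    show "\<forall>n\<in>{1..N}. finite {d. d ^ 2 dvd n}"
    proof
      fix n assume "n \<in> {1..N}"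
      then show "finite {d. d ^ 2 dvd n}"
        by (intro finite_subset[of "{d. d ^ 2 dvd n}" "{d. d dvd n}"]) (auto intro: dvd_trans[OF dvd_power])
    qed
  qed simp
  also have "\<dots> = (\<Sum>(d, k)\<in>Sigma {1..N} (\<lambda>d. {1..N div d ^ 2}). moebius k)"
  proof (rule sum.reindex_bij_witness[where i = "\<lambda>(d, k). (k * d ^ 2, d)" and j = "\<lambda>(n, d). (d, n div d ^ 2)"])
    fix x assume "x \<in> Sigma {1..N} (\<lambda>n. {d. d ^ 2 dvd n})"
    then obtain n d where x: "x = (n, d)" "1 \<le> n" "n \<le> N" "d ^ 2 dvd n" by auto
    then have "d > 0" by (cases "d = 0") auto
    have "d \<le> d ^ 2" by (simp add: power2_eq_square)
    also have "d ^ 2 \<le> n" using x by (intro dvd_imp_le) auto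
    finally have "d \<le> N" using x by simp
    moreover have "1 \<le> n div d ^ 2"
      using x \<open>d ^ 2 \<le> n\<close> \<open>d > 0\<close> by (simp add: Suc_le_eq div_greater_zero_iff)
    moreover have "n div d ^ 2 \<le> N div d ^ 2" using x by (intro div_le_mono) auto
    ultimately show "(case x of (n, d) \<Rightarrow> (d, n div d ^ 2)) \<in> Sigma {1..N} (\<lambda>d. {1..N div d ^ 2})"
      using x \<open>d > 0\<close> by auto
    show "(case case x of (n, d) \<Rightarrow> (d, n div d ^ 2) of (d, k) \<Rightarrow> (k * d ^ 2, d)) = x"
      using x by simp
  next
    fix y assume "y \<in> Sigma {1..N} (\<lambda>d. {1..N div d ^ 2})"
    then obtain d k where y: "y = (d, k)" "1 \<le> d" "1 \<le> k" "k \<le> N div d ^ 2" by auto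
    then have "k * d ^ 2 \<le> N" by (simp add: less_eq_div_iff_mult_less_eq)
    then show "(case y of (d, k) \<Rightarrow> (k * d ^ 2, d)) \<in> Sigma {1..N} (\<lambda>n. {d. d ^ 2 dvd n})"
      using y by auto
    show "(case case y of (d, k) \<Rightarrow> (k * d ^ 2, d) of (n, d) \<Rightarrow> (d, n div d ^ 2)) = y"
      using y by simp
  qed auto
  also have "\<dots> = (\<Sum>d=1..N. \<Sum>k=1..N div d ^ 2. moebius k)"
    by (rule sum.Sigma[symmetric]) auto
  finally show ?thesis .
qed

text \<open>
  With \<open>M\<close> the summatory function of \<open>\<mu>\<close>, the mean of \<open>\<lambda>\<close> is the sum over \<open>d\<close> of
  \<open>M(N / d\<^sup>2) / N\<close>. Each term tends to \<open>0\<close> and is at most \<open>1 / d\<^sup>2\<close> in size, so Tannery's theorem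
  allows passing to the limit under the sum.
\<close>

lemma liouville_mean_from_moebius_mean:
  assumes mu: "(\<lambda>N. real_of_int (\<Sum>n=1..N. moebius n) / real N) \<longlonglongrightarrow> 0"
  shows "(\<lambda>N. real_of_int (\<Sum>n=1..N. liouville n) / real N) \<longlonglongrightarrow> 0"
proof -
  define M where "M = (\<lambda>N. real_of_int (\<Sum>n=1..N. moebius n))"
  define a where "a = (\<lambda>d N. M (N div Suc d ^ 2) / real N)"
  have M: "\<bar>M N\<bar> \<le> real N" for N
  proof -
    have "\<bar>M N\<bar> \<le> (\<Sum>n=1..N. \<bar>real_of_int (moebius n)\<bar>)" unfolding M_def of_int_sum by (rule sum_abs)
    also have "\<dots> \<le> (\<Sum>n=1..N. 1)" by (intro sum_mono) (simp add: moebius_def)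
    finally show ?thesis by simp
  qed
  have "((\<lambda>N. a d N) \<longlongrightarrow> 0) sequentially" for d
  proof (rule Lim_null_comparison)
    show "(\<lambda>N. \<bar>M (N div Suc d ^ 2) / real (N div Suc d ^ 2)\<bar>) \<longlonglongrightarrow> 0"
      using filterlim_compose[OF mu filterlim_at_top_div_const_nat[of "Suc d ^ 2"]]
      by (intro tendsto_rabs_zero) (simp add: M_def)
    show "eventually (\<lambda>N. norm (a d N) \<le> \<bar>M (N div Suc d ^ 2) / real (N div Suc d ^ 2)\<bar>) sequentially"
    proof (intro always_eventually allI)
      fix N
      show "norm (a d N) \<le> \<bar>M (N div Suc d ^ 2) / real (N div Suc d ^ 2)\<bar>"
      proof (cases "N div Suc d ^ 2 = 0")
        case True
        then show ?thesis by (simp add: a_def M_def)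
      next
        case False
        then have "N > 0" by (cases N) auto
        with False have "\<bar>M (N div Suc d ^ 2)\<bar> / real N \<le> \<bar>M (N div Suc d ^ 2)\<bar> / real (N div Suc d ^ 2)"
          by (intro divide_left_mono) (auto simp del: of_nat_Suc)
        then show ?thesis by (simp add: a_def abs_divide)
      qed
    qed
  qed
  moreover have "eventually (\<lambda>(d, N). norm (a d N) \<le> 1 / (real d + 1) ^ 2) (at_top \<times>\<^sub>F sequentially)"
  proof (intro always_eventually allI, clarify)
    fix d N
    have "\<bar>M (N div Suc d ^ 2)\<bar> \<le> real (N div Suc d ^ 2)" by (rule M)
    also have "\<dots> \<le> real N / real (Suc d ^ 2)" by (rule of_nat_div_le_of_nat)
    finally have "\<bar>M (N div Suc d ^ 2)\<bar> / real N \<le> real N / real (Suc d ^ 2) / real N"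
      by (rule divide_right_mono) simp
    then have "norm (a d N) \<le> real N / real (Suc d ^ 2) / real N"
      by (simp only: a_def abs_divide real_norm_def abs_of_nat)
    also have "\<dots> \<le> 1 / real (Suc d ^ 2)" by (cases "N = 0") auto
    finally show "norm (a d N) \<le> 1 / (real d + 1) ^ 2" by (simp add: add.commute)
  qed
  moreover have "summable (\<lambda>d. 1 / (real d + 1) ^ 2)"
    using sums_summable[OF inverse_squares_sums] by (simp add: add.commute)
  ultimately have "(\<lambda>N. \<Sum>d. a d N) \<longlonglongrightarrow> (\<Sum>d. 0 :: real)"
    using tannerys_theorem[of a "\<lambda>_. 0" sequentially "\<lambda>d. 1 / (real d + 1) ^ 2"] by simp
  moreover have "(\<Sum>d. a d N) = real_of_int (\<Sum>n=1..N. liouville n) / real N" for N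
  proof -
    have "(\<Sum>d. a d N) = (\<Sum>d<N. a d N)"
    proof (rule suminf_finite)
      fix d assume "d \<notin> {..<N}"
      then have "N < Suc d" by simp
      also have "Suc d \<le> Suc d ^ 2" by (simp add: power2_eq_square)
      finally show "a d N = 0" by (simp add: a_def M_def)
    qed simp
    also have "\<dots> = (\<Sum>d=1..N. M (N div d ^ 2) / real N)"
      unfolding a_def by (rule sum.reindex_bij_witness[where i = "\<lambda>d. d - 1" and j = Suc]) auto
    also have "\<dots> = real_of_int (\<Sum>n=1..N. liouville n) / real N"
      unfolding sum_liouville_eq M_def of_int_sum sum_divide_distrib ..
    finally show ?thesis .
  qed
  ultimately show ?thesis by simp
qed

theorem lemma1:
  fixes f :: "nat \<Rightarrow> int"
  assumes "f = liouville \<or> f = moebius"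
  shows "(\<lambda>n::nat. real_of_int (\<Sum>i=1..n. \<Sum>j=1..n. f i * f j)) \<in> o(\<lambda>n. real n ^ 2)"
proof (rule smalloI_tendsto)
  have "(\<lambda>n. real_of_int (\<Sum>i=1..n. f i) / real n) \<longlonglongrightarrow> 0"
    using assms moebius_mean_tendsto_0 liouville_mean_from_moebius_mean[OF moebius_mean_tendsto_0]
    by auto
  then have "(\<lambda>n. (real_of_int (\<Sum>i=1..n. f i) / real n) ^ 2) \<longlonglongrightarrow> 0 ^ 2"
    by (rule tendsto_power)
  moreover have "real_of_int (\<Sum>i=1..n. \<Sum>j=1..n. f i * f j) / real n ^ 2
                   = (real_of_int (\<Sum>i=1..n. f i) / real n) ^ 2" for n :: nat
    unfolding sum_product[symmetric] by (simp add: power2_eq_square)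
  ultimately show "(\<lambda>n. real_of_int (\<Sum>i=1..n. \<Sum>j=1..n. f i * f j) / real n ^ 2) \<longlonglongrightarrow> 0"
    by simp
  show "eventually (\<lambda>n. real n ^ 2 \<noteq> 0) sequentially"
    using eventually_gt_at_top[of 0] by eventually_elim simp
qed

end
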